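(* Let $b$ be a graph over the discrete measure space $(X,m)$, let $d$ be an intrinsic metric for $b$ on $(X,m)$, and let $L$ be the associated graph Laplacian on $\ell^2(X,m)$ with operator domain $D(L)$. Let $\alpha_\infty=\sup\{\alpha(X\setminus K): K\subseteq X\text{ finite}\}$ be the isoperimetric constant at infinity. Assume $C_c(X)\subseteq D(L)$. Then $$\lambda_0^{\mathrm{ess}}(L)\ \ge\ \frac{\alpha_\infty^{2}}{2}.$$
   Context: Measure space: $X$ is a countably infinite set with the discrete topology, $m:X\to(0,\infty)$, and $m(A)=\sum_{x\in A}m(x)$ for $A\subseteq X$. Graph: a graph over $(X,m)$ is a symmetric function $b:X\times X\to[0,\infty)$ with $b(x,x)=0$ for all $x$ and $\sum_{y\in X}b(x,y)<\infty$ for all $x\in X$. Write $x\sim y$ (neighbors) if $b(x,y)>0$. It is assumed that every vertex has at least one neighbor. Intrinsic metric: a pseudo metric $d$ on $X$ is called an intrinsic metric for $b$ on $(X,m)$ if $\sum_{y\in X}b(x,y)d(x,y)^2\le m(x)$ for all $x\in X$. Isoperimetric constant: for $W\subseteq X$ let $\partial W=\{(x,y)\in W\times (X\setminus W): b(x,y)>0\}$ and $|\partial W|=\sum_{(x,y)\in\partial W}b(x,y)d(x,y)$. For $U\subseteq X$ set $\alpha(U)=\alpha_{d,m}(U)=\inf\{|\partial W|/m(W): W\subseteq U \text{ finite, nonempty}\}$. Laplacian: $\ell^2(X,m)$ is the real Hilbert space of functions $u:X\to\mathbb{R}$ with $\sum_x u(x)^2m(x)<\infty$, with inner product $\langle u,v\rangle=\sum_x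 u(x)v(x)m(x)$ and norm $\|\cdot\|$. $C_c(X)$ is the space of finitely supported real functions on $X$. The form $Q$ is $Q(u)=\frac12\sum_{x,y\in X}b(x,y)(u(x)-u(y))^2$ with domain $D=\overline{C_c(X)}^{\|\cdot\|_Q}$, where $\|u\|_Q=(Q(u)+\|u\|^2)^{1/2}$ (closure taken within $\{u\in\ell^2(X,m):Q(u)<\infty\}$). It is a closed form (a regular Dirichlet form), and $L$ denotes the corresponding positive selfadjoint operator on $\ell^2(X,m)$. $\lambda_0^{\mathrm{ess}}(L)=\inf\sigma_{\mathrm{ess}}(L)$ is the bottom of the essential spectrum of $L$ (with $\inf\emptyset=+\infty$); $\alpha_\infty$ takes values in $[0,\infty]$. *)

theory Defs
  imports "HOL-Analysis.Analysis"
begin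

text \<open>The vertex set \<open>X\<close> is the universe of the type \<open>'a\<close>, the measure is given by the
  vertex weights \<open>m\<close>. As all weights are positive, elements of \<open>\<ell>\<^sup>2(X,m)\<close> are genuine
  functions and no passage to equivalence classes is needed.\<close>

subsection \<open>Graphs, intrinsic metrics and isoperimetric constants\<close>

definition graph_over :: "('a \<Rightarrow> 'a \<Rightarrow> real) \<Rightarrow> bool" where
  "graph_over b \<longleftrightarrow>
     (\<forall>x y. 0 \<le> b x y) \<and> (\<forall>x y. b x y = b y x) \<and> (\<forall>x. b x x = 0) \<and>
     (\<forall>x. (\<lambda>y. b x y) summable_on UNIV) \<and> (\<forall>x. \<exists>y. 0 < b x y)"

definition pseudo_metric :: "('a \<Rightarrow> 'a \<Rightarrow> real) \<Rightarrow> bool" where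
  "pseudo_metric d \<longleftrightarrow>
     (\<forall>x y. 0 \<le> d x y) \<and> (\<forall>x. d x x = 0) \<and> (\<forall>x y. d x y = d y x) \<and>
     (\<forall>x y z. d x z \<le> d x y + d y z)"

definition intrinsic_metric ::
  "('a \<Rightarrow> 'a \<Rightarrow> real) \<Rightarrow> ('a \<Rightarrow> real) \<Rightarrow> ('a \<Rightarrow> 'a \<Rightarrow> real) \<Rightarrow> bool" where
  "intrinsic_metric b m d \<longleftrightarrow>
     pseudo_metric d \<and>
     (\<forall>x. (\<lambda>y. b x y * (d x y)\<^sup>2) summable_on UNIV \<and>
          (\<Sum>\<^sub>\<infinity>y. b x y * (d x y)\<^sup>2) \<le> m x)"

definition edge_boundary :: "('a \<Rightarrow> 'a \<Rightarrow> real) \<Rightarrow> 'a set \<Rightarrow> ('a \<times> 'a) set" where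
  "edge_boundary b W = {(x, y). x \<in> W \<and> y \<notin> W \<and> 0 < b x y}"

definition boundary_area ::
  "('a \<Rightarrow> 'a \<Rightarrow> real) \<Rightarrow> ('a \<Rightarrow> 'a \<Rightarrow> real) \<Rightarrow> 'a set \<Rightarrow> ennreal" where
  "boundary_area b d W = (\<Sum>\<^sub>\<infinity>(x, y)\<in>edge_boundary b W. ennreal (b x y * d x y))"

definition isoperimetric_const ::
  "('a \<Rightarrow> 'a \<Rightarrow> real) \<Rightarrow> ('a \<Rightarrow> real) \<Rightarrow> ('a \<Rightarrow> 'a \<Rightarrow> real) \<Rightarrow> 'a set \<Rightarrow> ennreal" where
  "isoperimetric_const b m d U =
     (INF W\<in>{W. finite W \<and> W \<noteq> {} \<and> W \<subseteq> U}. boundary_area b d W / ennreal (\<Sum>x\<in>W. m x))"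

definition isoperimetric_const_infinity ::
  "('a \<Rightarrow> 'a \<Rightarrow> real) \<Rightarrow> ('a \<Rightarrow> real) \<Rightarrow> ('a \<Rightarrow> 'a \<Rightarrow> real) \<Rightarrow> ennreal" where
  "isoperimetric_const_infinity b m d = (SUP K\<in>{K. finite K}. isoperimetric_const b m d (UNIV - K))"

subsection \<open>The space \<open>\<ell>\<^sup>2(X,m)\<close> and the energy form\<close>

definition l2 :: "('a \<Rightarrow> real) \<Rightarrow> ('a \<Rightarrow> real) set" where
  "l2 m = {u. (\<lambda>x. (u x)\<^sup>2 * m x) summable_on UNIV}"

definition l2_inner :: "('a \<Rightarrow> real) \<Rightarrow> ('a \<Rightarrow> real) \<Rightarrow> ('a \<Rightarrow> real) \<Rightarrow> real" where
  "l2_inner m u v = (\<Sum>\<^sub>\<infinity>x. u x * v x * m x)"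

definition l2_norm :: "('a \<Rightarrow> real) \<Rightarrow> ('a \<Rightarrow> real) \<Rightarrow> real" where
  "l2_norm m u = sqrt (l2_inner m u u)"

definition finitely_supported :: "('a \<Rightarrow> real) set" where
  "finitely_supported = {u. finite {x. u x \<noteq> 0}}"

definition finite_energy :: "('a \<Rightarrow> 'a \<Rightarrow> real) \<Rightarrow> ('a \<Rightarrow> real) \<Rightarrow> bool" where
  "finite_energy b u \<longleftrightarrow> (\<lambda>(x, y). b x y * (u x - u y)\<^sup>2) summable_on UNIV"

definition energy :: "('a \<Rightarrow> 'a \<Rightarrow> real) \<Rightarrow> ('a \<Rightarrow> real) \<Rightarrow> real" where
  "energy b u = (1/2) * (\<Sum>\<^sub>\<infinity>(x, y). b x y * (u x - u y)\<^sup>2)"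

text \<open>The symmetric bilinear form obtained from \<open>energy b\<close> by polarization.\<close>

definition energy_bilinear :: "('a \<Rightarrow> 'a \<Rightarrow> real) \<Rightarrow> ('a \<Rightarrow> real) \<Rightarrow> ('a \<Rightarrow> real) \<Rightarrow> real" where
  "energy_bilinear b u v = (1/2) * (\<Sum>\<^sub>\<infinity>(x, y). b x y * (u x - u y) * (v x - v y))"

definition form_norm :: "('a \<Rightarrow> 'a \<Rightarrow> real) \<Rightarrow> ('a \<Rightarrow> real) \<Rightarrow> ('a \<Rightarrow> real) \<Rightarrow> real" where
  "form_norm b m u = sqrt (energy b u + (l2_norm m u)\<^sup>2)"

definition form_domain :: "('a \<Rightarrow> 'a \<Rightarrow> real) \<Rightarrow> ('a \<Rightarrow> real) \<Rightarrow> ('a \<Rightarrow> real) set" where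
  "form_domain b m =
     {u \<in> l2 m. finite_energy b u \<and>
        (\<forall>\<epsilon>>0. \<exists>\<phi>\<in>finitely_supported. form_norm b m (\<lambda>x. u x - \<phi> x) < \<epsilon>)}"

subsection \<open>The Laplacian\<close>

text \<open>The selfadjoint operator of a closed form \<open>Q\<close> with domain \<open>D\<close>: a function \<open>u \<in> D\<close> lies
  in the operator domain with \<open>L u = f\<close> iff \<open>Q(u,v) = \<langle>f,v\<rangle>\<close> for all \<open>v \<in> D\<close>. The function
  \<open>f\<close> is unique because \<open>D\<close> contains the finitely supported functions; \<open>laplacian b m u\<close> is
  only meaningful for \<open>u \<in> laplacian_domain b m\<close>.\<close>

definition represents_form ::
  "('a \<Rightarrow> 'a \<Rightarrow> real) \<Rightarrow> ('a \<Rightarrow> real) \<Rightarrow> ('a \<Rightarrow> real) \<Rightarrow> ('a \<Rightarrow> real) \<Rightarrow> bool" where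
  "represents_form b m u f \<longleftrightarrow>
     f \<in> l2 m \<and> (\<forall>v\<in>form_domain b m. energy_bilinear b u v = l2_inner m f v)"

definition laplacian_domain :: "('a \<Rightarrow> 'a \<Rightarrow> real) \<Rightarrow> ('a \<Rightarrow> real) \<Rightarrow> ('a \<Rightarrow> real) set" where
  "laplacian_domain b m = {u \<in> form_domain b m. \<exists>f. represents_form b m u f}"

definition laplacian :: "('a \<Rightarrow> 'a \<Rightarrow> real) \<Rightarrow> ('a \<Rightarrow> real) \<Rightarrow> ('a \<Rightarrow> real) \<Rightarrow> ('a \<Rightarrow> real)" where
  "laplacian b m u = (THE f. represents_form b m u f)"

subsection \<open>Spectrum and essential spectrum of an operator on \<open>\<ell>\<^sup>2(X,m)\<close>\<close>

text \<open>An unbounded operator is a domain \<open>A\<close> together with a map \<open>T\<close>. Only real spectral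
  values are considered; for a selfadjoint operator these are all of them.\<close>

definition resolvent_set ::
  "('a \<Rightarrow> real) \<Rightarrow> ('a \<Rightarrow> real) set \<Rightarrow> (('a \<Rightarrow> real) \<Rightarrow> ('a \<Rightarrow> real)) \<Rightarrow> real set" where
  "resolvent_set m A T =
     {\<mu>. bij_betw (\<lambda>u x. T u x - \<mu> * u x) A (l2 m) \<and>
         (\<exists>C. \<forall>u\<in>A. l2_norm m u \<le> C * l2_norm m (\<lambda>x. T u x - \<mu> * u x))}"

definition spectrum_of ::
  "('a \<Rightarrow> real) \<Rightarrow> ('a \<Rightarrow> real) set \<Rightarrow> (('a \<Rightarrow> real) \<Rightarrow> ('a \<Rightarrow> real)) \<Rightarrow> real set" where
  "spectrum_of m A T = UNIV - resolvent_set m A T"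

definition eigenspace ::
  "('a \<Rightarrow> real) set \<Rightarrow> (('a \<Rightarrow> real) \<Rightarrow> ('a \<Rightarrow> real)) \<Rightarrow> real \<Rightarrow> ('a \<Rightarrow> real) set" where
  "eigenspace A T \<mu> = {u \<in> A. \<forall>x. T u x = \<mu> * u x}"

definition finite_dimensional :: "('a \<Rightarrow> real) set \<Rightarrow> bool" where
  "finite_dimensional E \<longleftrightarrow>
     (\<exists>B. finite B \<and> (\<forall>u\<in>E. \<exists>c. \<forall>x. u x = (\<Sum>f\<in>B. c f * f x)))"

text \<open>The discrete spectrum consists of the isolated points of the spectrum that are eigenvalues
  of finite multiplicity; the essential spectrum is its complement in the spectrum.\<close>

definition discrete_spectrum ::
  "('a \<Rightarrow> real) \<Rightarrow> ('a \<Rightarrow> real) set \<Rightarrow> (('a \<Rightarrow> real) \<Rightarrow> ('a \<Rightarrow> real)) \<Rightarrow> real set" where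
  "discrete_spectrum m A T =
     {\<mu>. \<mu> isolated_in spectrum_of m A T \<and>
         (\<exists>u\<in>eigenspace A T \<mu>. u \<noteq> (\<lambda>x. 0)) \<and> finite_dimensional (eigenspace A T \<mu>)}"

definition essential_spectrum ::
  "('a \<Rightarrow> real) \<Rightarrow> ('a \<Rightarrow> real) set \<Rightarrow> (('a \<Rightarrow> real) \<Rightarrow> ('a \<Rightarrow> real)) \<Rightarrow> real set" where
  "essential_spectrum m A T = spectrum_of m A T - discrete_spectrum m A T"

definition ess_spectrum_bottom ::
  "('a \<Rightarrow> real) \<Rightarrow> ('a \<Rightarrow> real) set \<Rightarrow> (('a \<Rightarrow> real) \<Rightarrow> ('a \<Rightarrow> real)) \<Rightarrow> ereal" where
  "ess_spectrum_bottom m A T = (INF \<mu>\<in>essential_spectrum m A T. ereal \<mu>)"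

end

theory Submission
  imports Defs
begin

text \<open>
  Write \<open>Q\<close> for the energy form, \<open>D\<close> for its domain and \<open>\<alpha>\<close> for the isoperimetric constant at
  infinity. The claim is that no real \<open>\<mu> < \<alpha>\<^sup>2 / 2\<close> belongs to the essential spectrum of \<open>L\<close>. The
  argument has a geometric and a functional analytic half, joined by a lower bound for \<open>Q\<close>.

  Geometry. Suppose \<open>a * m(W) \<le> \<bar>\<partial>W\<bar>\<close> for all finite \<open>W\<close> outside the finite set \<open>K\<close>. Peeling off
  superlevel sets one at a time turns this into the inequality
  \<open>2 * a * (\<Sum>x. f x * m x) \<le> (\<Sum>x y. b x y * d x y * \<bar>f x - f y\<bar>)\<close> for \<open>f \<ge> 0\<close> with finite support
  outside \<open>K\<close> (\<open>coarea_inequality\<close>). For \<open>f = \<phi>\<^sup>2\<close> the factorization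
  \<open>\<phi>(x)\<^sup>2 - \<phi>(y)\<^sup>2 = (\<phi> x - \<phi> y) * (\<phi> x + \<phi> y)\<close>, the Cauchy-Schwarz inequality and
  \<open>(\<Sum>y. b x y * d(x,y)\<^sup>2) \<le> m x\<close> bound the right-hand side by \<open>2 * sqrt (2 * Q \<phi>) * \<parallel>\<phi>\<parallel>\<close>, whence
  \<open>a\<^sup>2 / 2 * \<parallel>\<phi>\<parallel>\<^sup>2 \<le> Q \<phi>\<close> (\<open>cheeger_inequality\<close>).

  Localization. Cutting off the values on \<open>K\<close> is a finite rank operation, so for every
  \<open>c < a\<^sup>2 / 2\<close> it costs no more than a potential \<open>p \<ge> 0\<close> supported on \<open>K\<close>:
  \<open>c * \<parallel>u\<parallel>\<^sup>2 \<le> Q u + (\<Sum>x\<in>K. p x * u(x)\<^sup>2)\<close> for all \<open>u \<in> D\<close> (\<open>energy_plus_potential_bound\<close>).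

  Spectrum. Let \<open>\<mu> < c\<close>. Then \<open>Q - \<mu> + p\<close> is coercive on the Hilbert space \<open>D\<close>, and by Riesz
  representation \<open>L - \<mu> + p\<close> is invertible. As \<open>p\<close> has finite rank, \<open>L - \<mu>\<close> differs from an invertible
  operator by a perturbation that only sees the values on \<open>K\<close>. Hence solving
  \<open>(L - \<mu>) u = f\<close> is a square linear system of size \<open>card K\<close>, and either \<open>\<mu>\<close> is an eigenvalue
  or it is in the resolvent set (\<open>mem_resolvent_set_if_no_eigenfunction\<close>); eigenfunctions are
  determined by their values on \<open>K\<close> (\<open>eigenspace_finite_dimensional\<close>). Finally, more than
  \<open>card K\<close> eigenvalues below \<open>c\<close> would yield a nonzero combination \<open>u\<close> of their eigenfunctions that
  vanishes on \<open>K\<close>; but \<open>Q u < c * \<parallel>u\<parallel>\<^sup>2\<close> for such a combination (\<open>card_eigenvalues_below_le\<close>).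
  So the spectrum below \<open>c\<close> is a finite set of eigenvalues of finite multiplicity.
\<close>

section \<open>Positive semidefinite forms on spaces of functions\<close>

text \<open>The form may be degenerate on its space: the energy vanishes on constants, and the edge
  weight \<open>b\<close> vanishes at pairs that are not edges. The locale has four uses: the weighted
  \<open>\<ell>\<^sup>2\<close> spaces, the energy form, the form inner product, and the energy form perturbed by a potential.\<close>

locale function_inner_space =
  fixes V :: "('i \<Rightarrow> real) set" and h :: "('i \<Rightarrow> real) \<Rightarrow> ('i \<Rightarrow> real) \<Rightarrow> real"
  assumes zero_mem: "(\<lambda>i. 0) \<in> V"
    and lincomb_mem: "u \<in> V \<Longrightarrow> v \<in> V \<Longrightarrow> (\<lambda>i. s * u i + t * v i) \<in> V"
    and form_commute: "u \<in> V \<Longrightarrow> v \<in> V \<Longrightarrow> h u v = h v u"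
    and form_lincomb: "u \<in> V \<Longrightarrow> v \<in> V \<Longrightarrow> z \<in> V \<Longrightarrow>
          h (\<lambda>i. s * u i + t * v i) z = s * h u z + t * h v z"
    and form_nonneg: "u \<in> V \<Longrightarrow> 0 \<le> h u u"
begin

lemma add_mem: "u \<in> V \<Longrightarrow> v \<in> V \<Longrightarrow> (\<lambda>i. u i + v i) \<in> V"
  using lincomb_mem[of u v 1 1] by simp

lemma diff_mem: "u \<in> V \<Longrightarrow> v \<in> V \<Longrightarrow> (\<lambda>i. u i - v i) \<in> V"
  using lincomb_mem[of u v 1 "-1"] by simp

lemma scale_mem: "u \<in> V \<Longrightarrow> (\<lambda>i. t * u i) \<in> V"
  using lincomb_mem[of u u t 0] by simp

lemma sum_mem: "(\<And>k. k \<in> I \<Longrightarrow> g k \<in> V) \<Longrightarrow> (\<lambda>i. \<Sum>k\<in>I. w k * g k i) \<in> V"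
proof (induction I rule: infinite_finite_induct)
  case (insert k I)
  show ?case
    using lincomb_mem[of "g k" "\<lambda>i. \<Sum>k\<in>I. w k * g k i" "w k" 1] insert by simp
qed (simp_all add: zero_mem)

lemma form_scale: "u \<in> V \<Longrightarrow> z \<in> V \<Longrightarrow> h (\<lambda>i. t * u i) z = t * h u z"
  using form_lincomb[of u u z t 0] by simp

lemma form_zero: "z \<in> V \<Longrightarrow> h (\<lambda>i. 0) z = 0"
  using form_scale[of z z 0] by simp

lemma form_diff: "u \<in> V \<Longrightarrow> v \<in> V \<Longrightarrow> z \<in> V \<Longrightarrow> h (\<lambda>i. u i - v i) z = h u z - h v z"
  using form_lincomb[of u v z 1 "-1"] by simp

lemma form_sum:
  assumes "\<And>k. k \<in> I \<Longrightarrow> g k \<in> V" and "z \<in> V"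
  shows "h (\<lambda>i. \<Sum>k\<in>I. w k * g k i) z = (\<Sum>k\<in>I. w k * h (g k) z)"
  using assms(1)
proof (induction I rule: infinite_finite_induct)
  case (insert k I)
  show ?case
    using form_lincomb[of "g k" "\<lambda>i. \<Sum>k\<in>I. w k * g k i" z "w k" 1] insert sum_mem[of I g w] assms(2)
    by simp
qed (simp_all add: form_zero assms(2))

lemma form_square_lincomb:
  assumes "u \<in> V" "v \<in> V"
  shows "h (\<lambda>i. s * u i + t * v i) (\<lambda>i. s * u i + t * v i)
    = s\<^sup>2 * h u u + 2 * s * t * h u v + t\<^sup>2 * h v v"
proof -
  let ?z = "\<lambda>i. s * u i + t * v i"
  have z: "?z \<in> V" using assms by (rule lincomb_mem)
  have "h ?z ?z = s * h ?z u + t * h ?z v"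
    using form_lincomb[OF assms z] form_commute[OF z] assms by simp
  also have "\<dots> = s * (s * h u u + t * h v u) + t * (s * h u v + t * h v v)"
    using assms by (simp add: form_lincomb)
  finally show ?thesis
    using form_commute[OF assms] by (simp add: algebra_simps power2_eq_square)
qed

lemma form_square_diff:
  assumes "u \<in> V" "v \<in> V"
  shows "h (\<lambda>i. u i - v i) (\<lambda>i. u i - v i) = h u u - 2 * h u v + h v v"
  using form_square_lincomb[OF assms, of 1 "-1"] by simp

lemma cauchy_schwarz:
  assumes "u \<in> V" "v \<in> V"
  shows "(h u v)\<^sup>2 \<le> h u u * h v v"
proof -
  \<comment> \<open>The discriminant argument: the form is nonnegative on the span of \<open>u\<close> and \<open>v\<close>.\<close>
  have q: "0 \<le> s\<^sup>2 * h u u + 2 * s * t * h u v + t\<^sup>2 * h v v" for s t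
    using form_nonneg[OF lincomb_mem[OF assms, of s t]] form_square_lincomb[OF assms, of s t] by simp
  show ?thesis
  proof (cases "h v v = 0")
    case True
    have "h u v = 0"
    proof (rule ccontr)
      assume "h u v \<noteq> 0"
      then show False
        using q[of 1 "- (h u u + 1) / (2 * h u v)"] True by (simp add: field_simps)
    qed
    then show ?thesis using True by simp
  next
    case False
    then have "h v v > 0" using form_nonneg[OF assms(2)] by simp
    with q[of "h v v" "- h u v"] have "0 \<le> h v v * (h u u * h v v - (h u v)\<^sup>2)"
      by (simp add: algebra_simps power2_eq_square)
    with \<open>h v v > 0\<close> show ?thesis by (simp add: zero_le_mult_iff)
  qed
qed


definition seminorm :: "('i \<Rightarrow> real) \<Rightarrow> real" where
  "seminorm u = sqrt (h u u)"

lemma seminorm_power2: "u \<in> V \<Longrightarrow> (seminorm u)\<^sup>2 = h u u"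
  by (simp add: seminorm_def form_nonneg)

lemma seminorm_nonneg: "u \<in> V \<Longrightarrow> 0 \<le> seminorm u"
  by (simp add: seminorm_def form_nonneg)

lemma abs_form_le: "u \<in> V \<Longrightarrow> v \<in> V \<Longrightarrow> \<bar>h u v\<bar> \<le> seminorm u * seminorm v"
  using cauchy_schwarz[of u v] real_sqrt_le_mono
  by (fastforce simp: seminorm_def real_sqrt_mult simp flip: real_sqrt_abs)

lemma seminorm_triangle:
  assumes "u \<in> V" "v \<in> V"
  shows "seminorm (\<lambda>i. u i + v i) \<le> seminorm u + seminorm v"
proof (rule power2_le_imp_le)
  have "(seminorm (\<lambda>i. u i + v i))\<^sup>2 = h u u + 2 * h u v + h v v"
    using form_square_lincomb[OF assms, of 1 1] add_mem[OF assms] by (simp add: seminorm_power2)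
  also have "\<dots> \<le> (seminorm u + seminorm v)\<^sup>2"
    using abs_form_le[OF assms] assms by (simp add: power2_sum seminorm_power2)
  finally show "(seminorm (\<lambda>i. u i + v i))\<^sup>2 \<le> (seminorm u + seminorm v)\<^sup>2" .
qed (use assms in \<open>simp add: seminorm_nonneg\<close>)

lemma seminorm_scale: "u \<in> V \<Longrightarrow> seminorm (\<lambda>i. t * u i) = \<bar>t\<bar> * seminorm u"
  using form_square_lincomb[of u u t 0] by (simp add: seminorm_def real_sqrt_mult)

lemma seminorm_minus_commute:
  assumes "u \<in> V" "v \<in> V"
  shows "seminorm (\<lambda>i. u i - v i) = seminorm (\<lambda>i. v i - u i)"
  using form_commute[OF assms] by (simp add: seminorm_def form_square_diff assms)

lemma abs_form_le_mean:
  assumes "u \<in> V" "v \<in> V"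
  shows "2 * \<bar>h u v\<bar> \<le> h u u + h v v"
  using abs_form_le[OF assms] sum_squares_bound[of "seminorm u" "seminorm v"] assms
  by (simp add: seminorm_power2)

text \<open>Young's inequality for the mixed term. Only the factor of \<open>h u u\<close> has to be close to one.\<close>

lemma form_diff_le:
  assumes "u \<in> V" "v \<in> V" "\<delta> > 0"
  shows "h (\<lambda>i. u i - v i) (\<lambda>i. u i - v i) \<le> (1 + \<delta>) * h u u + (1 + 1 / \<delta>) * h v v"
proof -
  have "0 \<le> h (\<lambda>i. \<delta> * u i + 1 * v i) (\<lambda>i. \<delta> * u i + 1 * v i)"
    by (intro form_nonneg lincomb_mem assms)
  then have "0 \<le> \<delta> * h u u + 2 * h u v + h v v / \<delta>"
    unfolding form_square_lincomb[OF assms(1,2)] using \<open>\<delta> > 0\<close>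
    by (simp add: field_simps power2_eq_square)
  then show ?thesis unfolding form_square_diff[OF assms(1,2)] by (simp add: algebra_simps)
qed

lemma form_square_sum_le:
  assumes "finite I" "\<And>k. k \<in> I \<Longrightarrow> g k \<in> V"
  shows "h (\<lambda>i. \<Sum>k\<in>I. w k * g k i) (\<lambda>i. \<Sum>k\<in>I. w k * g k i)
    \<le> card I * (\<Sum>k\<in>I. (w k)\<^sup>2 * h (g k) (g k))"
proof -
  let ?u = "\<lambda>i. \<Sum>k\<in>I. w k * g k i" and ?q = "\<lambda>k. (w k)\<^sup>2 * h (g k) (g k)"
  have u: "?u \<in> V" by (rule sum_mem) (rule assms)
  have "h ?u ?u = (\<Sum>k\<in>I. w k * h (g k) ?u)"
    by (rule form_sum) (use assms u in auto)
  also have "\<dots> = (\<Sum>k\<in>I. \<Sum>j\<in>I. w k * w j * h (g k) (g j))"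
    using form_sum[of I g _ w] form_commute u assms(2)
    by (intro sum.cong) (auto simp: sum_distrib_left mult.assoc)
  also have "\<dots> \<le> (\<Sum>k\<in>I. \<Sum>j\<in>I. (?q k + ?q j) / 2)"
  proof (intro sum_mono)
    fix k j assume kj: "k \<in> I" "j \<in> I"
    have 1: "h (\<lambda>i. w k * g k i) (\<lambda>i. w j * g j i) = w k * w j * h (g k) (g j)" 
      if "k \<in> I" "j \<in> I" for k j
      using that assms(2) form_scale form_commute scale_mem by simp
    show "w k * w j * h (g k) (g j) \<le> (?q k + ?q j) / 2"
      using abs_form_le_mean[OF scale_mem scale_mem, of "g k" "g j" "w k" "w j"] assms(2) kj 1
      by (simp add: power2_eq_square)
  qed
  also have "\<dots> = card I * (\<Sum>k\<in>I. ?q k)"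
    by (simp add: sum.distrib sum_divide_distrib[symmetric] sum_distrib_left[symmetric])
  finally show ?thesis .
qed

text \<open>Convergence to \<open>u\<close> in the form seminorm is written out as \<open>h (s n - u) (s n - u) \<longlonglongrightarrow> 0\<close>
  throughout.\<close>

lemma form_tendsto:
  assumes s: "\<And>n. s n \<in> V" and u: "u \<in> V" and v: "v \<in> V"
    and lim: "(\<lambda>n::nat. h (\<lambda>i. s n i - u i) (\<lambda>i. s n i - u i)) \<longlonglongrightarrow> 0"
  shows "(\<lambda>n. h (s n) v) \<longlonglongrightarrow> h u v"
proof -
  have "(\<lambda>n. seminorm (\<lambda>i. s n i - u i) * seminorm v) \<longlonglongrightarrow> 0"
    using tendsto_mult_left_zero[OF tendsto_real_sqrt[OF lim, simplified]]
    unfolding seminorm_def by simp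
  then have "(\<lambda>n. h (\<lambda>i. s n i - u i) v) \<longlonglongrightarrow> 0"
    by (rule Lim_null_comparison[rotated])
      (use abs_form_le diff_mem s u v in \<open>auto intro!: always_eventually\<close>)
  then show ?thesis
    using form_diff s u v by (simp add: LIM_zero_iff)
qed

lemma form_square_tendsto:
  assumes s: "\<And>n. s n \<in> V" and u: "u \<in> V"
    and lim: "(\<lambda>n::nat. h (\<lambda>i. s n i - u i) (\<lambda>i. s n i - u i)) \<longlonglongrightarrow> 0"
  shows "(\<lambda>n. h (s n) (s n)) \<longlonglongrightarrow> h u u"
proof -
  have "(\<lambda>n. h (\<lambda>i. s n i - u i) (\<lambda>i. s n i - u i) + 2 * h (s n) u - h u u)
      \<longlonglongrightarrow> 0 + 2 * h u u - h u u"
    by (intro tendsto_intros lim form_tendsto s u)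
  then show ?thesis using form_square_diff s u by simp
qed

definition form_Cauchy :: "(nat \<Rightarrow> 'i \<Rightarrow> real) \<Rightarrow> bool" where
  "form_Cauchy s \<longleftrightarrow>
    (\<forall>e>0. \<exists>N. \<forall>n\<ge>N. \<forall>k\<ge>N. h (\<lambda>i. s n i - s k i) (\<lambda>i. s n i - s k i) < e)"

text \<open>The representing vector minimizes \<open>J v = h v v - 2 * l v\<close>. By the parallelogram law every
  minimizing sequence is Cauchy, and the first variation of \<open>J\<close> vanishes at its limit.\<close>

lemma riesz_representation:
  assumes complete: "\<And>s. (\<And>n. s n \<in> V) \<Longrightarrow> form_Cauchy s \<Longrightarrow>
      \<exists>u\<in>V. (\<lambda>n. h (\<lambda>i. s n i - u i) (\<lambda>i. s n i - u i)) \<longlonglongrightarrow> 0"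
    and l_lincomb: "\<And>u v s t. u \<in> V \<Longrightarrow> v \<in> V \<Longrightarrow> l (\<lambda>i. s * u i + t * v i) = s * l u + t * l v"
    and l_bounded: "\<And>v. v \<in> V \<Longrightarrow> (l v)\<^sup>2 \<le> C * h v v"
  shows "\<exists>u\<in>V. \<forall>v\<in>V. h u v = l v"
proof -
  define J where "J v = h v v - 2 * l v" for v
  define I where "I = Inf (J ` V)"
  have J_lower: "- \<bar>C\<bar> \<le> J v" if "v \<in> V" for v
  proof -
    have "(l v)\<^sup>2 \<le> \<bar>C\<bar> * h v v"
      using l_bounded[OF that] mult_right_mono[OF abs_ge_self[of C] form_nonneg[OF that]] by linarith
    then have "(2 * l v)\<^sup>2 \<le> (\<bar>C\<bar> + h v v)\<^sup>2"
      using sum_squares_bound[of "\<bar>C\<bar>" "h v v"] by (simp add: power2_sum)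
    then have "2 * l v \<le> \<bar>C\<bar> + h v v"
      by (rule power2_le_imp_le) (use form_nonneg[OF that] in simp)
    then show ?thesis by (simp add: J_def)
  qed
  have bdd: "bdd_below (J ` V)" using J_lower by (auto intro!: bdd_belowI2)
  have I_le: "I \<le> J v" if "v \<in> V" for v
    unfolding I_def using bdd that by (auto intro: cInf_lower)
  have "\<exists>v\<in>V. J v < I + 1 / Suc n" for n
    using cInf_lessD[of "J ` V" "I + 1 / Suc n"] zero_mem unfolding I_def by auto
  then obtain s where s: "\<And>n. s n \<in> V" and Js: "\<And>n. J (s n) < I + 1 / Suc n" by metis
  have parallelogram: "h (\<lambda>i. s n i - s k i) (\<lambda>i. s n i - s k i) < 2 / Suc n + 2 / Suc k" for n k
  proof -
    \<comment> \<open>The midpoint of two almost minimizers has value at least \<open>I\<close>, so they are close.\<close>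
    have "I \<le> J (\<lambda>i. 1/2 * s n i + 1/2 * s k i)" by (intro I_le lincomb_mem s)
    also have "\<dots> = h (s n) (s n) / 4 + h (s n) (s k) / 2 + h (s k) (s k) / 4 - l (s n) - l (s k)"
      unfolding J_def form_square_lincomb[OF s s] l_lincomb[OF s s] by (simp add: power2_eq_square)
    also have "\<dots> = J (s n) / 2 + J (s k) / 2 - h (\<lambda>i. s n i - s k i) (\<lambda>i. s n i - s k i) / 4"
      by (simp add: form_square_diff[OF s s] J_def field_simps)
    finally show ?thesis using Js[of n] Js[of k] by simp
  qed
  have "form_Cauchy s"
    unfolding form_Cauchy_def
  proof (intro allI impI)
    fix e :: real assume "e > 0"
    then obtain N where N: "1 / real (Suc N) < e / 4"
      using nat_approx_posE[of "e / 4"] by (auto)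
    have le: "1 / real (Suc n) \<le> 1 / real (Suc N)" if "n \<ge> N" for n
      using that by (simp add: frac_le)
    have "h (\<lambda>i. s n i - s k i) (\<lambda>i. s n i - s k i) < e" if "n \<ge> N" "k \<ge> N" for n k
      using parallelogram[of n k] le[OF that(1)] le[OF that(2)] N by simp
    then show "\<exists>N. \<forall>n\<ge>N. \<forall>k\<ge>N. h (\<lambda>i. s n i - s k i) (\<lambda>i. s n i - s k i) < e" by blast
  qed
  then obtain u where u: "u \<in> V" and lim: "(\<lambda>n. h (\<lambda>i. s n i - u i) (\<lambda>i. s n i - u i)) \<longlonglongrightarrow> 0"
    using complete s by blast
  have J_lim: "(\<lambda>n. J (s n)) \<longlonglongrightarrow> I"
  proof (rule tendsto_sandwich[of "\<lambda>_. I" _ _ "\<lambda>n. I + 1 / Suc n"])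
    show "(\<lambda>n. I + 1 / real (Suc n)) \<longlonglongrightarrow> I"
      using tendsto_add[OF tendsto_const LIMSEQ_inverse_real_of_nat, of I] by (simp add: inverse_eq_divide)
    show "\<forall>\<^sub>F n in sequentially. J (s n) \<le> I + 1 / Suc n"
      by (intro always_eventually allI less_imp_le Js)
  qed (simp_all add: I_le s)
  have "h u v = l v" if v: "v \<in> V" for v
  proof -
    have nonneg: "0 \<le> 2 * t * (h u v - l v) + t\<^sup>2 * h v v" for t
    proof (rule LIMSEQ_le_const)
      show "(\<lambda>n. J (s n) + 2 * t * (h (s n) v - l v) + t\<^sup>2 * h v v - I)
          \<longlonglongrightarrow> 2 * t * (h u v - l v) + t\<^sup>2 * h v v"
        using tendsto_diff[OF tendsto_add[OF tendsto_add[OF J_lim tendsto_mult[OF tendsto_const tendsto_diff[OF form_tendsto[OF s u v lim] tendsto_const]]] tendsto_const] tendsto_const, of "2 * t" "l v" "t\<^sup>2 * h v v" I] by simp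
      have "I \<le> J (s n) + 2 * t * (h (s n) v - l v) + t\<^sup>2 * h v v" for n
      proof -
        have "I \<le> J (\<lambda>i. 1 * s n i + t * v i)" by (intro I_le lincomb_mem s v)
        then show ?thesis
          unfolding J_def form_square_lincomb[OF s v] l_lincomb[OF s v] by (simp add: algebra_simps)
      qed
      then show "\<exists>N. \<forall>n\<ge>N. 0 \<le> J (s n) + 2 * t * (h (s n) v - l v) + t\<^sup>2 * h v v - I" by simp
    qed
    define e where "e = h u v - l v"
    define g where "g = h v v"
    have g: "g \<ge> 0" using form_nonneg[OF v] g_def by simp
    \<comment> \<open>The step \<open>t = - e / (g + 1)\<close> minimizes the quadratic up to the shift by one, which admits \<open>g = 0\<close>.\<close>
    define r where "r = 1 / (g + 1)"
    have r: "r > 0" "r * g \<le> 1" using g by (auto simp: r_def)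
    have "0 \<le> - 2 * (r * e\<^sup>2) + (r * e\<^sup>2) * (r * g)"
      using nonneg[of "- r * e"] by (simp add: e_def g_def power2_eq_square algebra_simps)
    also have "\<dots> \<le> - (r * e\<^sup>2)"
      using mult_left_mono[OF r(2), of "r * e\<^sup>2"] r(1) by simp
    finally have "e = 0" using r(1) by (simp add: mult_le_0_iff)
    then show ?thesis by (simp add: e_def)
  qed
  then show ?thesis using u by blast
qed

end

section \<open>Weighted square-summable functions\<close>

locale nonneg_weight =
  fixes w :: "'i \<Rightarrow> real"
  assumes weight_nonneg: "0 \<le> w i"
begin

lemma l2_product_summable:
  assumes "u \<in> l2 w" "v \<in> l2 w"
  shows "(\<lambda>i. u i * v i * w i) summable_on UNIV"
proof (rule abs_summable_summable, rule summable_on_comparison_test)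
  show "(\<lambda>i. (u i)\<^sup>2 * w i + (v i)\<^sup>2 * w i) summable_on UNIV"
    using assms by (intro summable_on_add) (auto simp: l2_def)
  fix i
  have "\<bar>u i * v i\<bar> \<le> (u i)\<^sup>2 + (v i)\<^sup>2"
    using sum_squares_bound[of "\<bar>u i\<bar>" "\<bar>v i\<bar>"] abs_ge_zero[of "u i * v i"] unfolding abs_mult power2_abs
    by linarith
  from mult_right_mono[OF this weight_nonneg[of i]]
  show "norm (u i * v i * w i) \<le> (u i)\<^sup>2 * w i + (v i)\<^sup>2 * w i"
    using weight_nonneg[of i] by (simp add: abs_mult algebra_simps)
qed auto

lemma l2_lincomb_mem:
  assumes "u \<in> l2 w" "v \<in> l2 w"
  shows "(\<lambda>i. s * u i + t * v i) \<in> l2 w"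
proof -
  have "(\<lambda>i. s\<^sup>2 * ((u i)\<^sup>2 * w i) + (2 * s * t) * (u i * v i * w i) + t\<^sup>2 * ((v i)\<^sup>2 * w i))
      summable_on UNIV"
    using assms by (intro summable_on_add summable_on_cmult_right l2_product_summable) (auto simp: l2_def)
  then show ?thesis
    by (simp add: l2_def power2_eq_square algebra_simps)
qed

lemma l2_inner_lincomb:
  assumes "u \<in> l2 w" "v \<in> l2 w" "z \<in> l2 w"
  shows "l2_inner w (\<lambda>i. s * u i + t * v i) z = s * l2_inner w u z + t * l2_inner w v z"
proof -
  have "l2_inner w (\<lambda>i. s * u i + t * v i) z
      = (\<Sum>\<^sub>\<infinity>i. s * (u i * z i * w i) + t * (v i * z i * w i))"
    by (simp add: l2_inner_def algebra_simps)
  also have "\<dots> = (\<Sum>\<^sub>\<infinity>i. s * (u i * z i * w i)) + (\<Sum>\<^sub>\<infinity>i. t * (v i * z i * w i))"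
    by (intro infsum_add summable_on_cmult_right l2_product_summable assms)
  finally show ?thesis
    by (simp add: l2_inner_def infsum_cmult_right')
qed

sublocale function_inner_space "l2 w" "l2_inner w"
proof
  show "(\<lambda>i. 0) \<in> l2 w" by (simp add: l2_def)
  show "0 \<le> l2_inner w u u" for u
    unfolding l2_inner_def using weight_nonneg by (intro infsum_nonneg) auto
  show "l2_inner w u v = l2_inner w v u" for u v
    unfolding l2_inner_def by (simp add: mult.commute)
qed (simp_all add: l2_lincomb_mem l2_inner_lincomb)

lemma pointwise_le_l2_inner:
  assumes "u \<in> l2 w"
  shows "(u i)\<^sup>2 * w i \<le> l2_inner w u u"
  using finite_sum_le_infsum[of "\<lambda>i. u i * u i * w i" UNIV "{i}"] l2_product_summable[OF assms assms]
    weight_nonneg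
  by (simp add: l2_inner_def power2_eq_square)

text \<open>Fatou's lemma: the bound passes to the limit on each finite set of indices, and the sum of a
  nonnegative function is the supremum over such sets.\<close>

lemma l2_fatou:
  assumes s: "\<And>n::nat. s n \<in> l2 w" and lim: "\<And>i. (\<lambda>n. s n i) \<longlonglongrightarrow> u i"
    and bound: "\<And>n. n \<ge> N \<Longrightarrow> l2_inner w (s n) (s n) \<le> C"
  shows "u \<in> l2 w" and "l2_inner w u u \<le> C"
proof -
  have part: "(\<Sum>i\<in>F. (u i)\<^sup>2 * w i) \<le> C" if "finite F" for F
  proof (rule LIMSEQ_le_const2)
    show "(\<lambda>n. \<Sum>i\<in>F. (s n i)\<^sup>2 * w i) \<longlonglongrightarrow> (\<Sum>i\<in>F. (u i)\<^sup>2 * w i)"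
      by (intro tendsto_intros lim)
    have "(\<Sum>i\<in>F. (s n i)\<^sup>2 * w i) \<le> C" if "n \<ge> N" for n
    proof -
      have "(\<Sum>i\<in>F. (s n i)\<^sup>2 * w i) \<le> l2_inner w (s n) (s n)"
        using finite_sum_le_infsum[of "\<lambda>i. s n i * s n i * w i" UNIV F] \<open>finite F\<close>
          l2_product_summable[OF s s] weight_nonneg
        by (simp add: l2_inner_def power2_eq_square)
      with bound[OF that] show ?thesis by simp
    qed
    then show "\<exists>N. \<forall>n\<ge>N. (\<Sum>i\<in>F. (s n i)\<^sup>2 * w i) \<le> C" by blast
  qed
  have sm: "(\<lambda>i. (u i)\<^sup>2 * w i) summable_on UNIV"
    using part weight_nonneg
    by (intro nonneg_bdd_above_summable_on) (auto intro!: bdd_aboveI2)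
  then show "u \<in> l2 w" by (simp add: l2_def)
  show "l2_inner w u u \<le> C"
    unfolding l2_inner_def using infsum_le_finite_sums[OF sm] part by (simp add: power2_eq_square)
qed

end

section \<open>The energy form and its domain\<close>

text \<open>The energy is half the squared norm of the gradient in the \<open>\<ell>\<^sup>2\<close> space over pairs of vertices
  with weight \<open>b\<close>. This reduces all statements about the energy to weighted \<open>\<ell>\<^sup>2\<close> spaces.\<close>

definition gradient :: "('a \<Rightarrow> real) \<Rightarrow> 'a \<times> 'a \<Rightarrow> real" where
  "gradient u = (\<lambda>(x, y). u x - u y)"

lemma gradient_lincomb:
  "gradient (\<lambda>x. s * u x + t * v x) = (\<lambda>e. s * gradient u e + t * gradient v e)"
  by (auto simp: gradient_def algebra_simps)

lemma finite_energy_iff_gradient: "finite_energy b u \<longleftrightarrow> gradient u \<in> l2 (case_prod b)"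
  by (simp add: finite_energy_def l2_def gradient_def case_prod_unfold mult.commute)

lemma energy_bilinear_eq_gradient:
  "energy_bilinear b u v = 1/2 * l2_inner (case_prod b) (gradient u) (gradient v)"
  unfolding energy_bilinear_def l2_inner_def
  by (simp add: gradient_def case_prod_unfold algebra_simps)

lemma energy_eq_bilinear: "energy b u = energy_bilinear b u u"
  by (simp add: energy_def energy_bilinear_def power2_eq_square mult.assoc)

definition point_mass :: "'a \<Rightarrow> 'a \<Rightarrow> real" where
  "point_mass x = (\<lambda>y. if y = x then 1 else 0)"

lemma point_mass_finitely_supported: "point_mass x \<in> finitely_supported"
  by (simp add: point_mass_def finitely_supported_def)

lemma l2_inner_point_mass: "l2_inner m u (point_mass x) = u x * m x"
proof -
  have "l2_inner m u (point_mass x) = (\<Sum>\<^sub>\<infinity>y\<in>{x}. u y * m y)"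
    unfolding l2_inner_def by (rule infsum_cong_neutral) (auto simp: point_mass_def)
  then show ?thesis by simp
qed

locale weighted_graph =
  fixes m :: "'a \<Rightarrow> real" and b :: "'a \<Rightarrow> 'a \<Rightarrow> real"
  assumes m_pos: "0 < m x"
    and graph: "graph_over b"
    and fs_form_domain: "finitely_supported \<subseteq> form_domain b m"
begin

lemma b_nonneg: "0 \<le> b x y"
  using graph by (simp add: graph_over_def)

lemma b_commute: "b x y = b y x"
  using graph by (simp add: graph_over_def)

sublocale vertices: nonneg_weight m
  by unfold_locales (rule less_imp_le[OF m_pos])

sublocale edges: nonneg_weight "case_prod b"
  by unfold_locales (auto simp: b_nonneg)

definition form_inner :: "('a \<Rightarrow> real) \<Rightarrow> ('a \<Rightarrow> real) \<Rightarrow> real" where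
  "form_inner u v = energy_bilinear b u v + l2_inner m u v"

lemmas energy_unfold = energy_bilinear_eq_gradient gradient_lincomb finite_energy_iff_gradient

text \<open>The norm defining the form domain is the seminorm of \<open>form_inner\<close> on the space of all
  \<open>\<ell>\<^sup>2\<close> functions of finite energy; the form domain is the closure of the finitely supported functions
  in that space.\<close>

sublocale maximal: function_inner_space "{u \<in> l2 m. finite_energy b u}" form_inner
proof (unfold_locales, goal_cases)
  case 1
  have "gradient (\<lambda>i::'a. 0) = (\<lambda>e. 0)" by (auto simp: gradient_def)
  then show ?case by (simp add: energy_unfold vertices.zero_mem edges.zero_mem)
next
  case (2 u v s t)
  then show ?case by (simp add: energy_unfold vertices.lincomb_mem edges.lincomb_mem)
next
  case (3 u v)
  then show ?case
    by (simp add: form_inner_def energy_unfold vertices.form_commute edges.form_commute)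
next
  case (4 u v z s t)
  then show ?case
    by (simp add: form_inner_def energy_unfold vertices.form_lincomb edges.form_lincomb algebra_simps)
next
  case (5 u)
  then show ?case
    by (simp add: form_inner_def energy_unfold vertices.form_nonneg edges.form_nonneg)
qed

lemma form_norm_eq_seminorm:
  assumes "u \<in> l2 m"
  shows "form_norm b m u = maximal.seminorm u"
  by (simp add: form_norm_def maximal.seminorm_def form_inner_def energy_eq_bilinear l2_norm_def
      vertices.form_nonneg assms)

lemma form_domain_iff:
  "u \<in> form_domain b m \<longleftrightarrow> u \<in> {u \<in> l2 m. finite_energy b u} \<and>
    (\<forall>\<epsilon>>0. \<exists>\<phi>\<in>finitely_supported. maximal.seminorm (\<lambda>x. u x - \<phi> x) < \<epsilon>)"
proof (cases "u \<in> l2 m")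
  case True
  have "form_norm b m (\<lambda>x. u x - \<phi> x) = maximal.seminorm (\<lambda>x. u x - \<phi> x)"
    if "\<phi> \<in> finitely_supported" for \<phi>
    using fs_form_domain that True
    by (intro form_norm_eq_seminorm vertices.diff_mem) (auto simp: form_domain_def)
  then show ?thesis by (auto simp: form_domain_def)
qed (simp add: form_domain_def)

lemma form_domain_maximal: "u \<in> form_domain b m \<Longrightarrow> u \<in> {u \<in> l2 m. finite_energy b u}"
  by (simp add: form_domain_def)

lemma finitely_supported_lincomb:
  assumes "u \<in> finitely_supported" "v \<in> finitely_supported"
  shows "(\<lambda>x. s * u x + t * v x) \<in> finitely_supported"
proof -
  have "finite ({x. u x \<noteq> 0} \<union> {x. v x \<noteq> 0})" using assms by (simp add: finitely_supported_def)
  then show ?thesis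
    unfolding finitely_supported_def mem_Collect_eq by (rule finite_subset[rotated]) auto
qed

lemma form_domain_lincomb:
  assumes "u \<in> form_domain b m" "v \<in> form_domain b m"
  shows "(\<lambda>x. s * u x + t * v x) \<in> form_domain b m"
  unfolding form_domain_iff
proof (intro conjI allI impI)
  note max = form_domain_maximal
  show "(\<lambda>x. s * u x + t * v x) \<in> {u \<in> l2 m. finite_energy b u}"
    by (intro maximal.lincomb_mem max assms)
  fix \<epsilon> :: real assume "\<epsilon> > 0"
  define \<delta> where "\<delta> = \<epsilon> / (\<bar>s\<bar> + \<bar>t\<bar> + 1)"
  have "\<delta> > 0" using \<open>\<epsilon> > 0\<close> by (simp add: \<delta>_def add_nonneg_pos)
  obtain \<phi> where \<phi>: "\<phi> \<in> finitely_supported" "maximal.seminorm (\<lambda>x. u x - \<phi> x) < \<delta>"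
    using assms(1) \<open>\<delta> > 0\<close> unfolding form_domain_iff by blast
  obtain \<psi> where \<psi>: "\<psi> \<in> finitely_supported" "maximal.seminorm (\<lambda>x. v x - \<psi> x) < \<delta>"
    using assms(2) \<open>\<delta> > 0\<close> unfolding form_domain_iff by blast
  have d: "(\<lambda>x. u x - \<phi> x) \<in> {u \<in> l2 m. finite_energy b u}"
      "(\<lambda>x. v x - \<psi> x) \<in> {u \<in> l2 m. finite_energy b u}"
    by (intro maximal.diff_mem max assms subsetD[OF fs_form_domain] \<phi>(1) \<psi>(1))+
  have "maximal.seminorm (\<lambda>x. s * u x + t * v x - (s * \<phi> x + t * \<psi> x))
      = maximal.seminorm (\<lambda>x. s * (u x - \<phi> x) + t * (v x - \<psi> x))"
    by (simp add: algebra_simps)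
  also have "\<dots> \<le> \<bar>s\<bar> * maximal.seminorm (\<lambda>x. u x - \<phi> x) + \<bar>t\<bar> * maximal.seminorm (\<lambda>x. v x - \<psi> x)"
    using maximal.seminorm_triangle[OF maximal.scale_mem[OF d(1)] maximal.scale_mem[OF d(2)], of s t]
    by (simp only: maximal.seminorm_scale[OF d(1)] maximal.seminorm_scale[OF d(2)])
  also have "\<dots> \<le> \<bar>s\<bar> * \<delta> + \<bar>t\<bar> * \<delta>"
    using \<phi>(2) \<psi>(2) by (intro add_mono mult_left_mono) auto
  also have "\<dots> < (\<bar>s\<bar> + \<bar>t\<bar> + 1) * \<delta>"
    using \<open>\<delta> > 0\<close> by (simp add: algebra_simps)
  also have "\<dots> = \<epsilon>" by (simp add: \<delta>_def add_nonneg_pos less_imp_neq[symmetric])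
  finally show "\<exists>\<phi>\<in>finitely_supported. maximal.seminorm (\<lambda>x. s * u x + t * v x - \<phi> x) < \<epsilon>"
    by (intro bexI[of _ "\<lambda>x. s * \<phi> x + t * \<psi> x"] finitely_supported_lincomb \<phi>(1) \<psi>(1))
qed

lemma form_domain_l2: "u \<in> form_domain b m \<Longrightarrow> u \<in> l2 m"
  by (simp add: form_domain_def)

lemma form_domain_gradient: "u \<in> form_domain b m \<Longrightarrow> gradient u \<in> l2 (case_prod b)"
  by (simp add: form_domain_def finite_energy_iff_gradient)

lemma zero_finitely_supported: "(\<lambda>x. 0) \<in> finitely_supported"
  by (simp add: finitely_supported_def)

sublocale form: function_inner_space "form_domain b m" form_inner
proof (unfold_locales, goal_cases)
  case 1
  then show ?case using fs_form_domain zero_finitely_supported by blast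
next
  case (2 u v s t)
  then show ?case by (rule form_domain_lincomb)
next
  case (3 u v)
  then show ?case by (intro maximal.form_commute form_domain_maximal)
next
  case (4 u v z s t)
  then show ?case by (intro maximal.form_lincomb form_domain_maximal)
next
  case (5 u)
  then show ?case by (intro maximal.form_nonneg form_domain_maximal)
qed

sublocale energy: function_inner_space "form_domain b m" "energy_bilinear b"
  by unfold_locales (auto simp: energy_unfold form.lincomb_mem form.zero_mem form_domain_gradient
      edges.form_commute edges.form_lincomb edges.form_nonneg algebra_simps)

text \<open>A Cauchy sequence converges pointwise, because each vertex has positive mass. The pointwise
  limit is the limit in norm by Fatou's lemma, applied to the functions and to their gradients.\<close>

lemma form_domain_complete:
  assumes s: "\<And>n. s n \<in> form_domain b m" and cauchy: "form.form_Cauchy s"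
  shows "\<exists>u\<in>form_domain b m. (\<lambda>n. form_inner (\<lambda>x. s n x - u x) (\<lambda>x. s n x - u x)) \<longlonglongrightarrow> 0"
proof -
  let ?M = "{u \<in> l2 m. finite_energy b u}"
  let ?d = "\<lambda>n k x. s n x - s k x"
  have d: "?d n k \<in> form_domain b m" for n k by (intro form.diff_mem s)
  have parts: "l2_inner m (?d n k) (?d n k) \<le> form_inner (?d n k) (?d n k)"
    "l2_inner (case_prod b) (gradient (?d n k)) (gradient (?d n k)) \<le> 2 * form_inner (?d n k) (?d n k)" for n k
    using energy.form_nonneg[OF d] vertices.form_nonneg[OF form_domain_l2[OF d]]
    by (simp_all add: form_inner_def energy_bilinear_eq_gradient)
  have "convergent (\<lambda>n. s n x)" for x
  proof (rule Cauchy_convergent, rule metric_CauchyI)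
    fix e :: real assume "e > 0"
    then have "e\<^sup>2 * m x > 0" using m_pos by simp
    then obtain N where N: "\<And>n k. n \<ge> N \<Longrightarrow> k \<ge> N \<Longrightarrow> form_inner (?d n k) (?d n k) < e\<^sup>2 * m x"
      using cauchy unfolding form.form_Cauchy_def by meson
    have "dist (s n x) (s k x) < e" if "n \<ge> N" "k \<ge> N" for n k
    proof -
      have "(?d n k x)\<^sup>2 * m x < e\<^sup>2 * m x"
        using vertices.pointwise_le_l2_inner[OF form_domain_l2[OF d[of n k]], of x] parts(1)[of n k] N[OF that]
        by linarith
      then have "\<bar>?d n k x\<bar>\<^sup>2 < e\<^sup>2" using m_pos[of x] by simp
      then show ?thesis
        using \<open>e > 0\<close> power2_less_imp_less[of "\<bar>?d n k x\<bar>" e] by (simp add: dist_real_def)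
    qed
    then show "\<exists>N. \<forall>n\<ge>N. \<forall>k\<ge>N. dist (s n x) (s k x) < e" by blast
  qed
  then have "\<exists>l. (\<lambda>n. s n x) \<longlonglongrightarrow> l" for x by (simp add: convergent_def)
  then obtain u where lim: "\<And>x. (\<lambda>n. s n x) \<longlonglongrightarrow> u x" by metis
  have close: "\<exists>N. \<forall>n\<ge>N. (\<lambda>x. s n x - u x) \<in> ?M \<and>
      form_inner (\<lambda>x. s n x - u x) (\<lambda>x. s n x - u x) < e" if "e > 0" for e
  proof -
    have "e / 4 > 0" using that by simp
    then obtain N where N: "\<And>n k. n \<ge> N \<Longrightarrow> k \<ge> N \<Longrightarrow> form_inner (?d n k) (?d n k) < e / 4"
      using cauchy unfolding form.form_Cauchy_def by meson
    have "(\<lambda>x. s n x - u x) \<in> ?M \<and> form_inner (\<lambda>x. s n x - u x) (\<lambda>x. s n x - u x) < e" if n: "n \<ge> N" for n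
    proof -
      have v: "(\<lambda>x. s n x - u x) \<in> l2 m"
        "l2_inner m (\<lambda>x. s n x - u x) (\<lambda>x. s n x - u x) \<le> e / 4"
      proof -
        have 1: "(\<lambda>k. ?d n k x) \<longlonglongrightarrow> s n x - u x" for x
          by (intro tendsto_intros lim)
        have 2: "l2_inner m (?d n k) (?d n k) \<le> e / 4" if "k \<ge> N" for k
          using parts(1)[of n k] N[OF n that] by linarith
        show "(\<lambda>x. s n x - u x) \<in> l2 m"
          "l2_inner m (\<lambda>x. s n x - u x) (\<lambda>x. s n x - u x) \<le> e / 4"
          using vertices.l2_fatou[OF form_domain_l2[OF d] 1 2] by blast+
      qed
      have g: "gradient (\<lambda>x. s n x - u x) \<in> l2 (case_prod b)"
        "l2_inner (case_prod b) (gradient (\<lambda>x. s n x - u x)) (gradient (\<lambda>x. s n x - u x)) \<le> 2 * (e / 4)"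
      proof -
        have 1: "(\<lambda>k. gradient (?d n k) i) \<longlonglongrightarrow> gradient (\<lambda>x. s n x - u x) i" for i
          unfolding gradient_def case_prod_unfold by (intro tendsto_intros lim)
        have 2: "l2_inner (case_prod b) (gradient (?d n k)) (gradient (?d n k)) \<le> 2 * (e / 4)" if "k \<ge> N" for k
          using parts(2)[of n k] N[OF n that] by linarith
        show "gradient (\<lambda>x. s n x - u x) \<in> l2 (case_prod b)"
          "l2_inner (case_prod b) (gradient (\<lambda>x. s n x - u x)) (gradient (\<lambda>x. s n x - u x)) \<le> 2 * (e / 4)"
          using edges.l2_fatou[OF form_domain_gradient[OF d] 1 2] by blast+
      qed
      show ?thesis
        using v g \<open>e > 0\<close> by (simp add: form_inner_def energy_bilinear_eq_gradient finite_energy_iff_gradient)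
    qed
    then show ?thesis by blast
  qed
  then have u_close: "\<exists>n. (\<lambda>x. s n x - u x) \<in> ?M \<and> maximal.seminorm (\<lambda>x. s n x - u x) < e" if "e > 0" for e
  proof -
    have "e\<^sup>2 > 0" using that by simp
    with close obtain n where n: "(\<lambda>x. s n x - u x) \<in> ?M" "form_inner (\<lambda>x. s n x - u x) (\<lambda>x. s n x - u x) < e\<^sup>2"
      by blast
    from real_sqrt_less_mono[OF n(2)] n(1) that show ?thesis unfolding maximal.seminorm_def by auto
  qed
  have u_max: "u \<in> ?M"
  proof -
    obtain n where "(\<lambda>x. s n x - u x) \<in> ?M" using u_close[of 1] by auto
    from maximal.diff_mem[OF form_domain_maximal[OF s[of n]] this] show ?thesis by simp
  qed
  have "u \<in> form_domain b m"
    unfolding form_domain_iff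
  proof (intro conjI u_max allI impI)
    fix \<epsilon> :: real assume "\<epsilon> > 0"
    then obtain n where n: "(\<lambda>x. s n x - u x) \<in> ?M" "maximal.seminorm (\<lambda>x. s n x - u x) < \<epsilon> / 2"
      using u_close[of "\<epsilon> / 2"] by auto
    obtain \<phi> where \<phi>: "\<phi> \<in> finitely_supported" "maximal.seminorm (\<lambda>x. s n x - \<phi> x) < \<epsilon> / 2"
      using s[of n] \<open>\<epsilon> > 0\<close> unfolding form_domain_iff by (meson half_gt_zero)
    have \<phi>_max: "(\<lambda>x. s n x - \<phi> x) \<in> ?M"
      using fs_form_domain \<phi>(1) by (intro maximal.diff_mem form_domain_maximal s) auto
    have "maximal.seminorm (\<lambda>x. (s n x - \<phi> x) + (u x - s n x)) < \<epsilon>"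
      using maximal.seminorm_triangle[OF \<phi>_max maximal.diff_mem[OF u_max form_domain_maximal[OF s[of n]]]]
        n(2) \<phi>(2) maximal.seminorm_minus_commute[OF u_max form_domain_maximal[OF s[of n]]]
      by simp
    then show "\<exists>\<phi>\<in>finitely_supported. maximal.seminorm (\<lambda>x. u x - \<phi> x) < \<epsilon>"
      using \<phi>(1) by auto
  qed
  moreover have "(\<lambda>n. form_inner (\<lambda>x. s n x - u x) (\<lambda>x. s n x - u x)) \<longlonglongrightarrow> 0"
  proof (rule LIMSEQ_I)
    fix e :: real assume "e > 0"
    from close[OF this] obtain N where N: "\<forall>n\<ge>N. (\<lambda>x. s n x - u x) \<in> ?M \<and>
      form_inner (\<lambda>x. s n x - u x) (\<lambda>x. s n x - u x) < e" by blast
    then show "\<exists>N. \<forall>n\<ge>N. norm (form_inner (\<lambda>x. s n x - u x) (\<lambda>x. s n x - u x) - 0) < e"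
      using maximal.form_nonneg by (intro exI[of _ N]) auto
  qed
  ultimately show ?thesis by blast
qed

lemma form_domain_approximation:
  assumes "u \<in> form_domain b m"
  shows "\<exists>\<phi>. (\<forall>n. \<phi> n \<in> finitely_supported) \<and>
    (\<lambda>n::nat. form_inner (\<lambda>x. \<phi> n x - u x) (\<lambda>x. \<phi> n x - u x)) \<longlonglongrightarrow> 0"
proof -
  have "\<exists>\<phi>\<in>finitely_supported. maximal.seminorm (\<lambda>x. u x - \<phi> x) < 1 / Suc n" for n
    using assms unfolding form_domain_iff by simp
  then obtain \<phi> where \<phi>: "\<And>n. \<phi> n \<in> finitely_supported"
    "\<And>n. maximal.seminorm (\<lambda>x. u x - \<phi> n x) < 1 / Suc n" by metis
  have \<phi>_dom: "\<phi> n \<in> form_domain b m" for n using \<phi>(1) fs_form_domain by blast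
  have "(\<lambda>n. maximal.seminorm (\<lambda>x. \<phi> n x - u x)) \<longlonglongrightarrow> 0"
  proof (rule tendsto_sandwich[of "\<lambda>_. 0" _ _ "\<lambda>n. 1 / real (Suc n)"])
    show "(\<lambda>n. 1 / real (Suc n)) \<longlonglongrightarrow> 0"
      using LIMSEQ_inverse_real_of_nat by (simp add: inverse_eq_divide)
    show "\<forall>\<^sub>F n in sequentially. 0 \<le> maximal.seminorm (\<lambda>x. \<phi> n x - u x)"
      by (intro always_eventually allI maximal.seminorm_nonneg maximal.diff_mem form_domain_maximal assms \<phi>_dom)
    show "\<forall>\<^sub>F n in sequentially. maximal.seminorm (\<lambda>x. \<phi> n x - u x) \<le> 1 / real (Suc n)"
      using \<phi>(2) maximal.seminorm_minus_commute[OF form_domain_maximal[OF assms] form_domain_maximal[OF \<phi>_dom]]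
      by (intro always_eventually allI) (simp add: less_imp_le)
  qed simp
  then have "(\<lambda>n. (maximal.seminorm (\<lambda>x. \<phi> n x - u x))\<^sup>2) \<longlonglongrightarrow> 0\<^sup>2" by (intro tendsto_intros)
  then have "(\<lambda>n. form_inner (\<lambda>x. \<phi> n x - u x) (\<lambda>x. \<phi> n x - u x)) \<longlonglongrightarrow> 0"
    using maximal.seminorm_power2[OF maximal.diff_mem[OF form_domain_maximal[OF \<phi>_dom] form_domain_maximal[OF assms]]]
    by simp
  then show ?thesis using \<phi>(1) by blast
qed

lemma point_mass_form_domain: "point_mass x \<in> form_domain b m"
  by (rule subsetD[OF fs_form_domain point_mass_finitely_supported])

text \<open>Evaluation at a vertex is continuous on \<open>\<ell>\<^sup>2\<close>: up to the factor \<open>m x\<close> it is the inner product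
  with a point mass.\<close>

lemma form_convergence_parts:
  assumes s: "\<And>n. s n \<in> form_domain b m" and u: "u \<in> form_domain b m"
    and lim: "(\<lambda>n::nat. form_inner (\<lambda>x. s n x - u x) (\<lambda>x. s n x - u x)) \<longlonglongrightarrow> 0"
  shows "(\<lambda>n. energy_bilinear b (\<lambda>x. s n x - u x) (\<lambda>x. s n x - u x)) \<longlonglongrightarrow> 0"
    and "(\<lambda>n. l2_inner m (\<lambda>x. s n x - u x) (\<lambda>x. s n x - u x)) \<longlonglongrightarrow> 0"
    and "(\<lambda>n. s n x) \<longlonglongrightarrow> u x"
proof -
  have d: "(\<lambda>x. s n x - u x) \<in> form_domain b m" for n by (intro form.diff_mem s u)
  note Q = energy.form_nonneg[OF d] and N = vertices.form_nonneg[OF form_domain_l2[OF d]]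
  show "(\<lambda>n. energy_bilinear b (\<lambda>x. s n x - u x) (\<lambda>x. s n x - u x)) \<longlonglongrightarrow> 0"
    by (rule Lim_null_comparison[OF _ lim]) (use Q N in \<open>auto simp: form_inner_def\<close>)
  show l2: "(\<lambda>n. l2_inner m (\<lambda>x. s n x - u x) (\<lambda>x. s n x - u x)) \<longlonglongrightarrow> 0"
    by (rule Lim_null_comparison[OF _ lim]) (use Q N in \<open>auto simp: form_inner_def\<close>)
  have "(\<lambda>n. s n x * m x) \<longlonglongrightarrow> u x * m x"
    using vertices.form_tendsto[OF form_domain_l2[OF s] form_domain_l2[OF u]
        form_domain_l2[OF point_mass_form_domain[of x]] l2]
    by (simp add: l2_inner_point_mass)
  from tendsto_divide[OF this tendsto_const, of "m x"] m_pos[of x]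
  show "(\<lambda>n. s n x) \<longlonglongrightarrow> u x" by (simp add: less_imp_neq[symmetric])
qed

lemma l2_inner_split:
  assumes "u \<in> l2 m" "finite K"
  shows "l2_inner m u u = (\<Sum>x\<in>K. m x * (u x)\<^sup>2)
    + l2_inner m (\<lambda>x. if x \<in> K then 0 else u x) (\<lambda>x. if x \<in> K then 0 else u x)"
proof -
  let ?f = "\<lambda>x. u x * u x * m x"
  have sm: "?f summable_on A" for A
    using vertices.l2_product_summable[OF assms(1) assms(1)] by (rule summable_on_subset) auto
  have "l2_inner m u u = infsum ?f (K \<union> - K)" by (simp add: l2_inner_def)
  also have "\<dots> = infsum ?f K + infsum ?f (- K)"
    by (intro infsum_Un_disjoint sm) auto
  also have "infsum ?f K = (\<Sum>x\<in>K. m x * (u x)\<^sup>2)"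
    using assms(2) by (simp add: power2_eq_square mult.commute)
  also have "infsum ?f (- K) = l2_inner m (\<lambda>x. if x \<in> K then 0 else u x) (\<lambda>x. if x \<in> K then 0 else u x)"
    unfolding l2_inner_def by (rule infsum_cong_neutral) auto
  finally show ?thesis .
qed

lemma point_mass_l2: "point_mass x \<in> l2 m"
  by (rule form_domain_l2[OF point_mass_form_domain])

lemma l2_inner_point_mass_left: "v \<in> l2 m \<Longrightarrow> l2_inner m (point_mass x) v = v x * m x"
  using vertices.form_commute[OF point_mass_l2] by (simp add: l2_inner_point_mass)

end

section \<open>The Cheeger inequality\<close>

text \<open>Fubini's theorem for functions supported on finitely many rows, or on finitely many columns.\<close>

lemma has_sum_pairs_finite_support:
  fixes k :: "'a \<Rightarrow> 'b \<Rightarrow> real"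
  assumes k_nonneg: "\<And>x y. 0 \<le> k x y" and k_summable: "\<And>x. k x summable_on UNIV"
    and S: "finite S" "\<And>x. x \<notin> S \<Longrightarrow> f x = 0" and f_nonneg: "\<And>x. 0 \<le> f x"
  shows "((\<lambda>(x, y). f x * k x y) has_sum (\<Sum>x\<in>S. f x * infsum (k x) UNIV)) UNIV"
    and "((\<lambda>(y, x). f x * k x y) has_sum (\<Sum>x\<in>S. f x * infsum (k x) UNIV)) UNIV"
proof -
  let ?g = "\<lambda>x. f x * infsum (k x) UNIV"
  have inner: "((\<lambda>y. case (x, y) of (x, y) \<Rightarrow> f x * k x y) has_sum ?g x) UNIV" for x
    using has_sum_cmult_right[OF has_sum_infsum[OF k_summable]] by simp
  have outer: "(?g has_sum (\<Sum>x\<in>S. ?g x)) UNIV"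
    by (rule has_sum_finite_neutralI) (use S in auto)
  have sm: "(\<lambda>(x, y). f x * k x y) summable_on (SIGMA x:UNIV. UNIV)"
    using inner has_sum_imp_summable[OF outer]
    by (rule summable_on_SigmaI) (use k_nonneg f_nonneg in auto)
  show *: "((\<lambda>(x, y). f x * k x y) has_sum (\<Sum>x\<in>S. ?g x)) UNIV"
    using has_sum_SigmaI[OF inner outer sm] by simp
  show "((\<lambda>(y, x). f x * k x y) has_sum (\<Sum>x\<in>S. ?g x)) UNIV"
    using * has_sum_swap[where f = "\<lambda>(x, y). f x * k x y" and A = UNIV and B = UNIV] by simp
qed

lemma ennreal_infsum:
  fixes f :: "'i \<Rightarrow> real"
  assumes "f summable_on A" "\<And>i. i \<in> A \<Longrightarrow> 0 \<le> f i"
  shows "(\<Sum>\<^sub>\<infinity>i\<in>A. ennreal (f i)) = ennreal (infsum f A)"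
proof -
  have "sum (ennreal \<circ> f) F = ennreal (sum f F)" if "finite F" "F \<subseteq> A" for F
    using assms(2) that by (auto simp: sum_ennreal subset_iff intro!: sum_ennreal)
  then show ?thesis
    using infsum_comm_additive_general[of A ennreal f] assms(1) by (simp add: o_def)
qed

locale intrinsic_graph = weighted_graph m b for m :: "'a \<Rightarrow> real" and b :: "'a \<Rightarrow> 'a \<Rightarrow> real" +
  fixes d :: "'a \<Rightarrow> 'a \<Rightarrow> real"
  assumes intrinsic: "intrinsic_metric b m d"
begin

lemma d_nonneg: "0 \<le> d x y"
  using intrinsic by (simp add: intrinsic_metric_def pseudo_metric_def)

lemma d_commute: "d x y = d y x"
  using intrinsic by (simp add: intrinsic_metric_def pseudo_metric_def)

lemma bd2_summable: "(\<lambda>y. b x y * (d x y)\<^sup>2) summable_on UNIV"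
  and bd2_le: "(\<Sum>\<^sub>\<infinity>y. b x y * (d x y)\<^sup>2) \<le> m x"
  using intrinsic by (simp_all add: intrinsic_metric_def)

text \<open>Compare \<open>d\<close> with \<open>1 + d\<^sup>2\<close>: the sum of \<open>b\<close> converges for a graph and that of \<open>b * d\<^sup>2\<close> for an
  intrinsic metric.\<close>

lemma bd_summable: "(\<lambda>y. b x y * d x y) summable_on UNIV"
proof (rule summable_on_comparison_test)
  show "(\<lambda>y. b x y + b x y * (d x y)\<^sup>2) summable_on UNIV"
    using graph by (intro summable_on_add bd2_summable) (unfold graph_over_def, blast)
  fix y
  have "0 \<le> (d x y - 1)\<^sup>2" by simp
  then have "d x y \<le> 1 + (d x y)\<^sup>2" using d_nonneg[of x y] unfolding power2_diff by simp
  from mult_left_mono[OF this b_nonneg[of x y]]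
  show "b x y * d x y \<le> b x y + b x y * (d x y)\<^sup>2" by (simp add: algebra_simps)
qed (simp_all add: b_nonneg d_nonneg)

definition total_variation :: "('a \<Rightarrow> real) \<Rightarrow> real" where
  "total_variation f = (\<Sum>\<^sub>\<infinity>(x, y). b x y * d x y * \<bar>f x - f y\<bar>)"

definition perimeter :: "'a set \<Rightarrow> real" where
  "perimeter W = (\<Sum>\<^sub>\<infinity>(x, y)\<in>edge_boundary b W. b x y * d x y)"

lemma variation_summable:
  assumes "finite S" "\<And>x. x \<notin> S \<Longrightarrow> f x = 0" "\<And>x. 0 \<le> f x"
  shows "(\<lambda>(x, y). b x y * d x y * \<bar>f x - f y\<bar>) summable_on UNIV"
proof (rule summable_on_comparison_test)
  let ?k = "\<lambda>x y. b x y * d x y"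
  note sums = has_sum_pairs_finite_support[of ?k S f]
  show "(\<lambda>e. (case e of (x, y) \<Rightarrow> f x * ?k x y) + (case e of (y, x) \<Rightarrow> f x * ?k x y)) summable_on UNIV"
    using sums assms bd_summable
    by (intro summable_on_add has_sum_imp_summable) (auto simp: b_nonneg d_nonneg)
  fix e :: "'a \<times> 'a"
  obtain x y where e: "e = (x, y)" by (cases e)
  have "\<bar>f x - f y\<bar> \<le> f x + f y" using assms(3)[of x] assms(3)[of y] by simp
  from mult_left_mono[OF this, of "?k x y"]
  show "(case e of (x, y) \<Rightarrow> b x y * d x y * \<bar>f x - f y\<bar>)
      \<le> (case e of (x, y) \<Rightarrow> f x * ?k x y) + (case e of (y, x) \<Rightarrow> f x * ?k x y)"
    using b_commute[of x y] d_commute[of x y] by (simp add: e b_nonneg d_nonneg algebra_simps)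
qed (auto simp: b_nonneg d_nonneg)

lemma boundary_summable:
  assumes "finite W"
  shows "(\<lambda>(x, y). b x y * d x y) summable_on edge_boundary b W"
proof -
  have "(\<lambda>(x, y). b x y * d x y * \<bar>(if x \<in> W then 1 else 0) - (if y \<in> W then 1 else 0)\<bar>)
      summable_on edge_boundary b W"
    by (rule summable_on_subset[OF variation_summable[OF assms]]) auto
  then show ?thesis
    by (rule summable_on_cong[THEN iffD1, rotated]) (auto simp: edge_boundary_def)
qed

lemma boundary_area_eq_perimeter:
  assumes "finite W"
  shows "boundary_area b d W = ennreal (perimeter W)"
  using ennreal_infsum[OF boundary_summable[OF assms]]
  by (auto simp: boundary_area_def perimeter_def b_nonneg d_nonneg case_prod_unfold)

text \<open>The isoperimetric constant is an infimum of extended nonnegative quotients; for finite sets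
  these quotients are real numbers.\<close>

lemma isoperimetric_const_le_perimeter:
  assumes "ennreal a \<le> isoperimetric_const b m d U" and "0 \<le> a"
    and W: "finite W" "W \<noteq> {}" "W \<subseteq> U"
  shows "a * (\<Sum>x\<in>W. m x) \<le> perimeter W"
proof -
  have M: "(\<Sum>x\<in>W. m x) > 0" using W m_pos by (intro sum_pos) auto
  have P: "perimeter W \<ge> 0"
    unfolding perimeter_def using b_nonneg d_nonneg by (intro infsum_nonneg) auto
  have "isoperimetric_const b m d U \<le> boundary_area b d W / ennreal (\<Sum>x\<in>W. m x)"
    unfolding isoperimetric_const_def using W by (intro INF_lower) simp
  also have "\<dots> = ennreal (perimeter W / (\<Sum>x\<in>W. m x))"
    using boundary_area_eq_perimeter[OF W(1)] divide_ennreal[OF P M] by simp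
  finally have "ennreal a \<le> ennreal (perimeter W / (\<Sum>x\<in>W. m x))"
    using assms(1) by (rule order_trans[rotated])
  then have "a \<le> perimeter W / (\<Sum>x\<in>W. m x)" using P M by (subst (asm) ennreal_le_iff) auto
  then show ?thesis using M by (simp add: pos_le_divide_eq)
qed

text \<open>The total variation runs over ordered pairs, so it meets each boundary edge twice, while the
  perimeter only counts the pairs that leave \<open>W\<close>.\<close>

lemma total_variation_indicator:
  assumes "finite W"
  shows "total_variation (\<lambda>x. if x \<in> W then 1 else 0) = 2 * perimeter W"
proof -
  let ?E = "edge_boundary b W" and ?k = "\<lambda>(x, y). b x y * d x y"
  have "total_variation (\<lambda>x. if x \<in> W then 1 else 0) = infsum ?k (?E \<union> prod.swap ` ?E)"
    unfolding total_variation_def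
  proof (rule infsum_cong_neutral, goal_cases)
    case (2 e)
    obtain x y where e: "e = (x, y)" by (cases e)
    have "b x y = 0" if "(x \<in> W) \<noteq> (y \<in> W)"
      using 2 that b_nonneg[of x y] b_commute[of x y] unfolding e edge_boundary_def
      by (auto simp: image_iff less_le)
    then show ?case by (auto simp: e)
  next
    case (3 e)
    then show ?case by (auto simp: edge_boundary_def)
  qed auto
  also have "\<dots> = infsum ?k ?E + infsum ?k (prod.swap ` ?E)"
  proof (rule infsum_Un_disjoint)
    show "?k summable_on prod.swap ` ?E"
      using boundary_summable[OF assms] b_commute d_commute
      by (subst summable_on_reindex) (auto simp: o_def case_prod_unfold)
  qed (use boundary_summable[OF assms] in \<open>auto simp: edge_boundary_def\<close>)
  also have "infsum ?k (prod.swap ` ?E) = infsum ?k ?E"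
    using b_commute d_commute by (subst infsum_reindex) (auto simp: o_def case_prod_unfold)
  finally show ?thesis by (simp add: perimeter_def)
qed

text \<open>The functions \<open>t\<close> times the indicator of \<open>S\<close> and the rest of \<open>f\<close> are ordered in the same way:
  their differences over a pair never have opposite signs, so absolute values add up.\<close>

lemma total_variation_split_level:
  assumes "finite S" "t \<ge> 0" "\<And>x. x \<in> S \<Longrightarrow> t \<le> f x" "\<And>x. x \<notin> S \<Longrightarrow> f x = 0"
  shows "total_variation f = 2 * t * perimeter S + total_variation (\<lambda>x. if x \<in> S then f x - t else 0)"
proof -
  let ?ind = "\<lambda>x. if x \<in> S then 1 else 0 :: real" and ?g = "\<lambda>x. if x \<in> S then f x - t else 0"
  have "\<bar>f x - f y\<bar> = t * \<bar>?ind x - ?ind y\<bar> + \<bar>?g x - ?g y\<bar>" for x y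
    using assms(2) assms(3,4)[of x] assms(3,4)[of y] by auto
  then have "total_variation f = (\<Sum>\<^sub>\<infinity>e. t * (case e of (x, y) \<Rightarrow> b x y * d x y * \<bar>?ind x - ?ind y\<bar>)
      + (case e of (x, y) \<Rightarrow> b x y * d x y * \<bar>?g x - ?g y\<bar>))"
    unfolding total_variation_def by (simp add: case_prod_unfold algebra_simps)
  also have "\<dots> = t * total_variation ?ind + total_variation ?g"
    unfolding total_variation_def infsum_cmult_right'[symmetric]
    using assms by (intro infsum_add summable_on_cmult_right variation_summable[of S]) auto
  finally show ?thesis using total_variation_indicator[OF assms(1)] by simp
qed

text \<open>The discrete layer-cake argument. Subtracting the least value of \<open>f\<close> on its support \<open>S\<close>
  splits off one multiple of the perimeter of \<open>S\<close> and leaves a function of strictly smaller support.\<close>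

lemma coarea_inequality:
  assumes isoperimetric: "\<And>W. finite W \<Longrightarrow> W \<noteq> {} \<Longrightarrow> W \<subseteq> U \<Longrightarrow> a * (\<Sum>x\<in>W. m x) \<le> perimeter W"
    and "finite S" "S \<subseteq> U" "\<And>x. x \<in> S \<Longrightarrow> 0 < f x" "\<And>x. x \<notin> S \<Longrightarrow> f x = 0"
  shows "2 * a * (\<Sum>x\<in>S. f x * m x) \<le> total_variation f"
  using assms(2-)
proof (induction S arbitrary: f rule: finite_psubset_induct)
  case (psubset S)
  show ?case
  proof (cases "S = {}")
    case True
    then show ?thesis by (simp add: total_variation_def psubset.prems case_prod_unfold)
  next
    case False
    define t where "t = Min (f ` S)"
    define g where "g = (\<lambda>x. if x \<in> S then f x - t else 0)"
    define S' where "S' = {x \<in> S. f x \<noteq> t}"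
    have t_le: "t \<le> f x" if "x \<in> S" for x
      using that psubset.hyps by (simp add: t_def)
    obtain x0 where x0: "x0 \<in> S" "f x0 = t"
    proof -
      have "t \<in> f ` S" unfolding t_def by (rule Min_in) (simp_all add: False psubset.hyps)
      then show ?thesis using that by blast
    qed
    have "t > 0" using x0 psubset.prems(2) by auto
    have "2 * a * (\<Sum>x\<in>S'. g x * m x) \<le> total_variation g"
    proof (rule psubset.IH)
      show "S' \<subset> S" "S' \<subseteq> U" using x0 psubset.prems(1) by (auto simp: S'_def)
      show "0 < g x" if "x \<in> S'" for x
        using that t_le[of x] by (auto simp: S'_def g_def)
      show "g x = 0" if "x \<notin> S'" for x
        using that by (auto simp: S'_def g_def)
    qed
    moreover have "(\<Sum>x\<in>S'. g x * m x) = (\<Sum>x\<in>S. g x * m x)"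
      by (rule sum.mono_neutral_left) (auto simp: S'_def g_def psubset.hyps)
    moreover have "(\<Sum>x\<in>S. f x * m x) = t * (\<Sum>x\<in>S. m x) + (\<Sum>x\<in>S. g x * m x)"
      unfolding sum_distrib_left sum.distrib[symmetric] by (rule sum.cong) (auto simp: g_def algebra_simps)
    moreover have "t * (a * (\<Sum>x\<in>S. m x)) \<le> t * perimeter S"
      using isoperimetric[of S] psubset False \<open>t > 0\<close> by (intro mult_left_mono) auto
    moreover have "total_variation f = 2 * t * perimeter S + total_variation g"
      unfolding g_def using total_variation_split_level[of S t f] t_le psubset \<open>t > 0\<close> by simp
    ultimately show ?thesis by (simp add: algebra_simps)
  qed
qed

text \<open>This is the place where the metric has to be intrinsic: after
  \<open>(\<phi> x + \<phi> y)\<^sup>2 \<le> 2 * \<phi>(x)\<^sup>2 + 2 * \<phi>(y)\<^sup>2\<close>, summing \<open>b * d\<^sup>2\<close> over one variable gives at most the mass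
  of the other.\<close>

lemma metric_times_sum_in_l2:
  assumes "\<phi> \<in> finitely_supported"
  shows "(\<lambda>(x, y). d x y * \<bar>\<phi> x + \<phi> y\<bar>) \<in> l2 (case_prod b)" (is "?g \<in> _")
    and "l2_inner (case_prod b) (\<lambda>(x, y). d x y * \<bar>\<phi> x + \<phi> y\<bar>) (\<lambda>(x, y). d x y * \<bar>\<phi> x + \<phi> y\<bar>)
      \<le> 4 * l2_inner m \<phi> \<phi>"
proof -
  let ?k = "\<lambda>x y. b x y * (d x y)\<^sup>2" and ?S = "{x. \<phi> x \<noteq> 0}"
  let ?s = "\<Sum>x\<in>?S. (\<phi> x)\<^sup>2 * infsum (?k x) UNIV"
  have S: "finite ?S" using assms by (simp add: finitely_supported_def)
  have sums: "((\<lambda>(x, y). (\<phi> x)\<^sup>2 * ?k x y) has_sum ?s) UNIV" "((\<lambda>(y, x). (\<phi> x)\<^sup>2 * ?k x y) has_sum ?s) UNIV"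
    using has_sum_pairs_finite_support[of ?k ?S "\<lambda>x. (\<phi> x)\<^sup>2"] S bd2_summable b_nonneg by auto
  let ?major = "\<lambda>e. 2 * (case e of (x, y) \<Rightarrow> (\<phi> x)\<^sup>2 * ?k x y) + 2 * (case e of (y, x) \<Rightarrow> (\<phi> x)\<^sup>2 * ?k x y)"
  have major: "(?major has_sum (2 * ?s + 2 * ?s)) UNIV"
    using sums by (intro has_sum_add has_sum_cmult_right)
  have le: "(?g e)\<^sup>2 * case_prod b e \<le> ?major e" for e
  proof -
    obtain x y where e: "e = (x, y)" by (cases e)
    have "(\<phi> x + \<phi> y)\<^sup>2 \<le> 2 * (\<phi> x)\<^sup>2 + 2 * (\<phi> y)\<^sup>2"
      using sum_squares_bound[of "\<phi> x" "\<phi> y"] unfolding power2_sum by simp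
    from mult_left_mono[OF this, of "?k x y"] b_nonneg[of x y]
    show ?thesis using b_commute[of x y] d_commute[of x y]
      by (simp add: e power_mult_distrib algebra_simps)
  qed
  have sm: "(\<lambda>e. (?g e)\<^sup>2 * case_prod b e) summable_on UNIV"
    by (rule summable_on_comparison_test[OF has_sum_imp_summable[OF major] le])
       (auto simp: b_nonneg)
  then show g: "?g \<in> l2 (case_prod b)" by (simp add: l2_def)
  have "l2_inner (case_prod b) ?g ?g = (\<Sum>\<^sub>\<infinity>e. (?g e)\<^sup>2 * case_prod b e)"
    by (simp add: l2_inner_def power2_eq_square)
  also have "\<dots> \<le> 2 * ?s + 2 * ?s"
    by (rule has_sum_mono[OF has_sum_infsum[OF sm] major le])
  also have "\<dots> = 4 * ?s" by simp
  also have "?s \<le> (\<Sum>x\<in>?S. (\<phi> x)\<^sup>2 * m x)"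
    using bd2_le by (intro sum_mono mult_left_mono) auto
  also have "\<dots> = l2_inner m \<phi> \<phi>"
    unfolding l2_inner_def infsum_finite[OF S, symmetric]
    by (rule infsum_cong_neutral) (auto simp: power2_eq_square)
  finally show "l2_inner (case_prod b) ?g ?g \<le> 4 * l2_inner m \<phi> \<phi>" by simp
qed

text \<open>The total variation of \<open>\<phi>\<^sup>2\<close> is the inner product of \<open>\<bar>\<phi> x - \<phi> y\<bar>\<close> and
  \<open>d x y * \<bar>\<phi> x + \<phi> y\<bar>\<close> over the edges. The coarea inequality bounds it from below, the
  Cauchy-Schwarz inequality from above.\<close>

theorem cheeger_inequality:
  assumes isoperimetric: "\<And>W. finite W \<Longrightarrow> W \<noteq> {} \<Longrightarrow> W \<subseteq> U \<Longrightarrow> a * (\<Sum>x\<in>W. m x) \<le> perimeter W"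
    and "0 \<le> a" and \<phi>: "\<phi> \<in> finitely_supported" "\<And>x. x \<notin> U \<Longrightarrow> \<phi> x = 0"
  shows "a\<^sup>2 / 2 * l2_inner m \<phi> \<phi> \<le> energy_bilinear b \<phi> \<phi>"
proof -
  let ?S = "{x. \<phi> x \<noteq> 0}"
  let ?N = "l2_inner m \<phi> \<phi>" and ?Q = "energy_bilinear b \<phi> \<phi>"
  let ?g = "\<lambda>(x, y). d x y * \<bar>\<phi> x + \<phi> y\<bar>" and ?h = "\<lambda>e. \<bar>gradient \<phi> e\<bar>"
  have S: "finite ?S" using \<phi> by (simp add: finitely_supported_def)
  have \<phi>_dom: "\<phi> \<in> form_domain b m" using \<phi> fs_form_domain by blast
  have N: "?N = (\<Sum>x\<in>?S. (\<phi> x)\<^sup>2 * m x)"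
    unfolding l2_inner_def infsum_finite[OF S, symmetric]
    by (rule infsum_cong_neutral) (auto simp: power2_eq_square)
  have "?N \<ge> 0" "?Q \<ge> 0"
    using vertices.form_nonneg energy.form_nonneg \<phi>_dom form_domain_l2 by auto
  have h: "?h \<in> l2 (case_prod b)" "l2_inner (case_prod b) ?h ?h = 2 * ?Q"
    using form_domain_gradient[OF \<phi>_dom]
    by (simp_all add: l2_def energy_bilinear_eq_gradient l2_inner_def)
  have "2 * a * ?N \<le> total_variation (\<lambda>x. (\<phi> x)\<^sup>2)"
    unfolding N using \<phi>(2) by (intro coarea_inequality[OF isoperimetric]) (auto simp: S)
  also have "\<dots> = l2_inner (case_prod b) ?h ?g"
    unfolding total_variation_def l2_inner_def
    by (rule infsum_cong) (auto simp: gradient_def abs_mult[symmetric] power2_eq_square algebra_simps)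
  finally have "2 * a * ?N \<le> l2_inner (case_prod b) ?h ?g" .
  then have "(2 * a * ?N)\<^sup>2 \<le> (l2_inner (case_prod b) ?h ?g)\<^sup>2"
    using \<open>0 \<le> a\<close> \<open>?N \<ge> 0\<close> by (intro power_mono) auto
  also have "\<dots> \<le> (2 * ?Q) * l2_inner (case_prod b) ?g ?g"
    using edges.cauchy_schwarz[OF h(1) metric_times_sum_in_l2(1)[OF \<phi>(1)]] h(2) by simp
  also have "\<dots> \<le> (2 * ?Q) * (4 * ?N)"
    using metric_times_sum_in_l2(2)[OF \<phi>(1)] \<open>?Q \<ge> 0\<close> by (intro mult_left_mono) auto
  finally have "?N * (a\<^sup>2 * ?N) \<le> ?N * (2 * ?Q)"
    by (simp add: power2_eq_square algebra_simps)
  then show ?thesis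
    using \<open>?N \<ge> 0\<close> \<open>?Q \<ge> 0\<close> by (cases "?N = 0") (auto simp: mult_le_cancel_left)
qed

section \<open>A lower bound for the energy up to a finite potential\<close>

text \<open>The function is cut into its parts on and off \<open>K\<close>. The part off \<open>K\<close> obeys the Cheeger
  inequality. The part on \<open>K\<close> is a combination of \<open>card K\<close> point masses, so its energy is bounded by
  its squared values. The mixed term is absorbed at the price of the factor \<open>1 + \<delta>\<close>.\<close>

lemma energy_plus_potential_bound_finitely_supported:
  assumes isoperimetric: "\<And>W. finite W \<Longrightarrow> W \<noteq> {} \<Longrightarrow> W \<subseteq> - K \<Longrightarrow> a * (\<Sum>x\<in>W. m x) \<le> perimeter W"
    and "0 \<le> a" and K: "finite K" and "\<delta> > 0" and \<phi>: "\<phi> \<in> finitely_supported"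
  shows "a\<^sup>2 / 2 * l2_inner m \<phi> \<phi> \<le> (1 + \<delta>) * energy_bilinear b \<phi> \<phi> +
    (\<Sum>x\<in>K. ((1 + 1 / \<delta>) * card K * energy_bilinear b (point_mass x) (point_mass x) + a\<^sup>2 / 2 * m x) * (\<phi> x)\<^sup>2)"
proof -
  let ?Q = "\<lambda>u. energy_bilinear b u u"
  define \<phi>in where "\<phi>in = (\<lambda>y. \<Sum>x\<in>K. \<phi> x * point_mass x y)"
  define \<phi>out where "\<phi>out = (\<lambda>x. if x \<in> K then 0 else \<phi> x)"
  have \<phi>in_eq: "\<phi>in y = (if y \<in> K then \<phi> y else 0)" for y
  proof -
    have "\<phi>in y = (\<Sum>x\<in>K. if x = y then \<phi> x else 0)"
      unfolding \<phi>in_def point_mass_def by (rule sum.cong) auto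
    then show ?thesis using K by simp
  qed
  have out_diff: "\<phi>out = (\<lambda>x. \<phi> x - \<phi>in x)" by (auto simp: \<phi>out_def \<phi>in_eq)
  have \<phi>_dom: "\<phi> \<in> form_domain b m" using \<phi> fs_form_domain by blast
  have in_dom: "\<phi>in \<in> form_domain b m"
    unfolding \<phi>in_def by (intro form.sum_mem point_mass_form_domain)
  have "\<phi>out \<in> finitely_supported"
    using \<phi> unfolding finitely_supported_def mem_Collect_eq \<phi>out_def by (rule rev_finite_subset) auto
  then have "a\<^sup>2 / 2 * l2_inner m \<phi>out \<phi>out \<le> ?Q \<phi>out"
    by (intro cheeger_inequality[OF isoperimetric \<open>0 \<le> a\<close>]) (auto simp: \<phi>out_def)
  also have "\<dots> \<le> (1 + \<delta>) * ?Q \<phi> + (1 + 1 / \<delta>) * ?Q \<phi>in"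
    unfolding out_diff by (rule energy.form_diff_le[OF \<phi>_dom in_dom \<open>\<delta> > 0\<close>])
  also have "\<dots> \<le> (1 + \<delta>) * ?Q \<phi> + (1 + 1 / \<delta>) * (card K * (\<Sum>x\<in>K. (\<phi> x)\<^sup>2 * ?Q (point_mass x)))"
    using energy.form_square_sum_le[OF K, of point_mass \<phi>] point_mass_form_domain \<open>\<delta> > 0\<close>
    unfolding \<phi>in_def by (intro add_left_mono mult_left_mono) auto
  finally show ?thesis
    using l2_inner_split[OF form_domain_l2[OF \<phi>_dom] K]
    unfolding \<phi>out_def[symmetric]
    by (simp add: distrib_left distrib_right sum.distrib sum_distrib_left mult_ac)
qed

text \<open>The slack between \<open>c\<close> and \<open>a\<^sup>2 / 2\<close> pays for the factor \<open>1 + \<delta>\<close>, and both sides are continuous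
  in the form norm.\<close>

theorem energy_plus_potential_bound:
  assumes isoperimetric: "\<And>W. finite W \<Longrightarrow> W \<noteq> {} \<Longrightarrow> W \<subseteq> - K \<Longrightarrow> a * (\<Sum>x\<in>W. m x) \<le> perimeter W"
    and "0 \<le> a" and K: "finite K" and c: "0 \<le> c" "c < a\<^sup>2 / 2"
  shows "\<exists>p. (\<forall>x. 0 \<le> p x) \<and>
    (\<forall>u\<in>form_domain b m. c * l2_inner m u u \<le> energy_bilinear b u u + (\<Sum>x\<in>K. p x * (u x)\<^sup>2))"
proof -
  define \<delta> where "\<delta> = (a\<^sup>2 / 2 - c) / (a\<^sup>2 / 2)"
  have "a\<^sup>2 / 2 > 0" using c by linarith
  then have "\<delta> > 0" using c by (simp add: \<delta>_def)
  have "c * \<delta> \<le> (a\<^sup>2 / 2) * \<delta>" using c \<open>\<delta> > 0\<close> by (intro mult_right_mono) auto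
  also have "\<dots> = a\<^sup>2 / 2 - c" using \<open>a\<^sup>2 / 2 > 0\<close> by (simp add: \<delta>_def)
  finally have \<delta>: "(1 + \<delta>) * c \<le> a\<^sup>2 / 2" by (simp add: algebra_simps)
  define p where "p = (\<lambda>x. (1 + 1 / \<delta>) * card K * energy_bilinear b (point_mass x) (point_mass x) + a\<^sup>2 / 2 * m x)"
  have p: "0 \<le> p x" for x
    using \<open>\<delta> > 0\<close> energy.form_nonneg[OF point_mass_form_domain, of x] m_pos[of x]
    by (simp add: p_def)
  have bound: "c * l2_inner m \<phi> \<phi> \<le> energy_bilinear b \<phi> \<phi> + (\<Sum>x\<in>K. p x * (\<phi> x)\<^sup>2)"
    if \<phi>: "\<phi> \<in> finitely_supported" for \<phi>
  proof -
    let ?N = "l2_inner m \<phi> \<phi>" and ?P = "\<Sum>x\<in>K. p x * (\<phi> x)\<^sup>2"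
    have "?N \<ge> 0" using \<phi> fs_form_domain by (intro vertices.form_nonneg form_domain_l2) auto
    have "?P \<ge> 0" using p by (intro sum_nonneg) auto
    have "(1 + \<delta>) * (c * ?N) \<le> a\<^sup>2 / 2 * ?N"
      using mult_right_mono[OF \<delta> \<open>?N \<ge> 0\<close>] by (simp add: mult.assoc)
    also have "\<dots> \<le> (1 + \<delta>) * energy_bilinear b \<phi> \<phi> + ?P"
      unfolding p_def
      by (rule energy_plus_potential_bound_finitely_supported[OF isoperimetric \<open>0 \<le> a\<close> K \<open>\<delta> > 0\<close> \<phi>])
    also have "\<dots> \<le> (1 + \<delta>) * (energy_bilinear b \<phi> \<phi> + ?P)"
      using \<open>\<delta> > 0\<close> \<open>?P \<ge> 0\<close> by (simp add: algebra_simps)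
    finally show ?thesis using \<open>\<delta> > 0\<close> by simp
  qed
  have "c * l2_inner m u u \<le> energy_bilinear b u u + (\<Sum>x\<in>K. p x * (u x)\<^sup>2)"
    if u: "u \<in> form_domain b m" for u
  proof -
    obtain \<phi> where \<phi>: "\<And>n. \<phi> n \<in> finitely_supported"
      and lim: "(\<lambda>n::nat. form_inner (\<lambda>x. \<phi> n x - u x) (\<lambda>x. \<phi> n x - u x)) \<longlonglongrightarrow> 0"
      using form_domain_approximation[OF u] by blast
    have \<phi>_dom: "\<phi> n \<in> form_domain b m" for n using \<phi> fs_form_domain by blast
    note parts = form_convergence_parts[OF \<phi>_dom u lim]
    show ?thesis
    proof (rule LIMSEQ_le)
      show "(\<lambda>n. c * l2_inner m (\<phi> n) (\<phi> n)) \<longlonglongrightarrow> c * l2_inner m u u"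
        by (intro tendsto_mult_left vertices.form_square_tendsto parts form_domain_l2 \<phi>_dom u)
      show "(\<lambda>n. energy_bilinear b (\<phi> n) (\<phi> n) + (\<Sum>x\<in>K. p x * (\<phi> n x)\<^sup>2))
          \<longlonglongrightarrow> energy_bilinear b u u + (\<Sum>x\<in>K. p x * (u x)\<^sup>2)"
        by (intro tendsto_intros energy.form_square_tendsto parts \<phi>_dom u)
    qed (use bound \<phi> in blast)
  qed
  then show ?thesis using p by blast
qed

end

section \<open>The Laplacian as a weak equation\<close>

context weighted_graph
begin

lemma represents_form_unique:
  assumes "represents_form b m u f" "represents_form b m u g"
  shows "f = g"
proof
  fix x
  have "f x * m x = g x * m x"
    using assms point_mass_form_domain[of x] unfolding represents_form_def
    by (metis l2_inner_point_mass)
  then show "f x = g x" using m_pos[of x] by simp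
qed

lemma laplacian_eqI: "represents_form b m u f \<Longrightarrow> laplacian b m u = f"
  unfolding laplacian_def using represents_form_unique by blast

lemma represents_form_laplacian:
  "u \<in> laplacian_domain b m \<Longrightarrow> represents_form b m u (laplacian b m u)"
  using laplacian_eqI by (auto simp: laplacian_domain_def)

text \<open>The resolvent equation \<open>(L - \<mu>) u = f\<close> in weak form, which moves all later arguments from
  the operator to the form. The function representing the form is unique because point masses are
  admissible as test functions.\<close>

lemma laplacian_shift_eq_iff:
  "u \<in> laplacian_domain b m \<and> (\<lambda>x. laplacian b m u x - \<mu> * u x) = f \<longleftrightarrow>
   u \<in> form_domain b m \<and> f \<in> l2 m \<and>
     (\<forall>v\<in>form_domain b m. energy_bilinear b u v - \<mu> * l2_inner m u v = l2_inner m f v)"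
  (is "?L \<longleftrightarrow> ?R")
proof
  assume L: ?L
  then have u: "u \<in> form_domain b m" by (simp add: laplacian_domain_def)
  have rep: "laplacian b m u \<in> l2 m"
    "\<And>v. v \<in> form_domain b m \<Longrightarrow> energy_bilinear b u v = l2_inner m (laplacian b m u) v"
    using represents_form_laplacian L by (auto simp: represents_form_def)
  have f: "f = (\<lambda>x. laplacian b m u x - \<mu> * u x)" using L by auto
  show ?R
    unfolding f
    using vertices.form_lincomb[OF rep(1) form_domain_l2[OF u], where s = 1 and t = "- \<mu>"]
      vertices.lincomb_mem[OF rep(1) form_domain_l2[OF u], of 1 "- \<mu>"] form_domain_l2 u rep(2)
    by simp
next
  assume R: ?R
  let ?g = "\<lambda>x. f x + \<mu> * u x"
  have "represents_form b m u ?g"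
    using R vertices.form_lincomb[of f u _ 1 \<mu>] vertices.lincomb_mem[of f u 1 \<mu>] form_domain_l2
    by (auto simp: represents_form_def algebra_simps)
  then show ?L using R laplacian_eqI by (auto simp: laplacian_domain_def)
qed

lemma eigenspace_laplacian_iff:
  "u \<in> eigenspace (laplacian_domain b m) (laplacian b m) \<mu> \<longleftrightarrow>
   u \<in> form_domain b m \<and>
     (\<forall>v\<in>form_domain b m. energy_bilinear b u v = \<mu> * l2_inner m u v)"
  using laplacian_shift_eq_iff[of u \<mu> "\<lambda>x. 0"] vertices.zero_mem vertices.form_zero form_domain_l2
  by (auto simp: eigenspace_def fun_eq_iff)

end

section \<open>The spectrum below the lower bound\<close>

text \<open>Gaussian elimination. This is the only fact about finite dimension in the proof: it serves
  both for the Fredholm alternative and for counting eigenvalues.\<close>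

lemma underdetermined_system:
  fixes A :: "'e \<Rightarrow> 'v \<Rightarrow> real"
  assumes "finite E" "finite V" "card E < card V"
  shows "\<exists>w. (\<exists>k\<in>V. w k \<noteq> 0) \<and> (\<forall>e\<in>E. (\<Sum>k\<in>V. A e k * w k) = 0)"
  using assms
proof (induction E arbitrary: V A rule: finite_induct)
  case empty
  then have "V \<noteq> {}" by auto
  then show ?case by (intro exI[of _ "\<lambda>_. 1"]) auto
next
  case (insert e E)
  show ?case
  proof (cases "\<forall>k\<in>V. A e k = 0")
    case True
    have "card E < card V" using insert by simp
    from insert.IH[OF insert.prems(1) this, of A] True show ?thesis by auto
  next
    case False
    then obtain q where q: "q \<in> V" "A e q \<noteq> 0" by blast
    \<comment> \<open>Eliminate the unknown \<open>q\<close> from the other equations by means of the equation \<open>e\<close>.\<close>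
    let ?V = "V - {q}" and ?B = "\<lambda>e' k. A e' k - A e' q * A e k / A e q"
    have "finite ?V" "card E < card ?V" using insert q by auto
    from insert.IH[OF this, of ?B] obtain w where w: "\<exists>k\<in>?V. w k \<noteq> 0"
      "\<And>e'. e' \<in> E \<Longrightarrow> (\<Sum>k\<in>?V. ?B e' k * w k) = 0" by blast
    define w' where "w' = w(q := - (\<Sum>k\<in>?V. A e k * w k) / A e q)"
    have split: "(\<Sum>k\<in>V. A e' k * w' k)
        = (\<Sum>k\<in>?V. A e' k * w k) - A e' q / A e q * (\<Sum>k\<in>?V. A e k * w k)" for e'
    proof -
      have "(\<Sum>k\<in>V. A e' k * w' k) = A e' q * w' q + (\<Sum>k\<in>?V. A e' k * w' k)"
        using insert.prems(1) q(1) by (rule sum.remove)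
      also have "(\<Sum>k\<in>?V. A e' k * w' k) = (\<Sum>k\<in>?V. A e' k * w k)"
        by (rule sum.cong) (auto simp: w'_def)
      finally show ?thesis by (simp add: w'_def)
    qed
    have "(\<Sum>k\<in>V. A e' k * w' k) = 0" if "e' \<in> E" for e'
      using w(2)[OF that] unfolding split
      by (simp add: sum_subtractf sum_distrib_left algebra_simps)
    moreover have "(\<Sum>k\<in>V. A e k * w' k) = 0" unfolding split using q(2) by simp
    moreover have "\<exists>k\<in>V. w' k \<noteq> 0" using w(1) by (auto simp: w'_def)
    ultimately show ?thesis by blast
  qed
qed

text \<open>The remaining input from the geometry is a lower bound \<open>c\<close> for the energy plus a finitely
  supported potential.\<close>

locale bounded_below_with_potential = weighted_graph m b
  for m :: "'a \<Rightarrow> real" and b :: "'a \<Rightarrow> 'a \<Rightarrow> real" +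
  fixes K :: "'a set" and p :: "'a \<Rightarrow> real" and c :: real
  assumes finite_K: "finite K" and p_nonneg: "0 \<le> p x" and c_nonneg: "0 \<le> c"
    and bounded_below: "u \<in> form_domain b m \<Longrightarrow>
      c * l2_inner m u u \<le> energy_bilinear b u u + (\<Sum>x\<in>K. p x * (u x)\<^sup>2)"
begin

abbreviation "eigen \<equiv> eigenspace (laplacian_domain b m) (laplacian b m)"

definition perturbed :: "real \<Rightarrow> ('a \<Rightarrow> real) \<Rightarrow> ('a \<Rightarrow> real) \<Rightarrow> real" where
  "perturbed \<mu> u v = energy_bilinear b u v - \<mu> * l2_inner m u v + (\<Sum>x\<in>K. p x * u x * v x)"

definition coercivity :: "real \<Rightarrow> real" where
  "coercivity \<mu> = (c - \<mu>) / (1 + c + \<bar>\<mu>\<bar>)"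

lemma coercivity_pos: "\<mu> < c \<Longrightarrow> 0 < coercivity \<mu>"
  using c_nonneg by (simp add: coercivity_def add_pos_nonneg)

text \<open>A fraction \<open>k\<close> of the energy is kept, and \<open>1 - k\<close> of it is used against \<open>\<mu>\<close>. This requires
  \<open>k \<le> (1 - k) * c - \<mu>\<close>, which holds for \<open>k = (c - \<mu>) / (1 + c + \<bar>\<mu>\<bar>)\<close> and any smaller \<open>k\<close>; the
  summand \<open>\<bar>\<mu>\<bar>\<close> in the denominator ensures \<open>k \<le> 1\<close> for negative \<open>\<mu>\<close>.\<close>

lemma perturbed_coercive:
  assumes "\<mu> < c" and u: "u \<in> form_domain b m"
  shows "coercivity \<mu> * form_inner u u \<le> perturbed \<mu> u u"
proof -
  let ?k = "coercivity \<mu>" and ?Q = "energy_bilinear b u u" and ?N = "l2_inner m u u"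
    and ?P = "\<Sum>x\<in>K. p x * (u x)\<^sup>2"
  have D: "1 + c + \<bar>\<mu>\<bar> > 0" using c_nonneg by (simp add: add_pos_nonneg)
  have k_eq: "?k * (1 + c + \<bar>\<mu>\<bar>) = c - \<mu>" using D by (simp add: coercivity_def)
  have "?k \<le> 1" unfolding coercivity_def using D by (simp add: divide_le_eq)
  have "?k * (1 + c) \<le> c - \<mu>"
    using mult_nonneg_nonneg[OF less_imp_le[OF coercivity_pos[OF assms(1)]] abs_ge_zero[of \<mu>]]
    unfolding k_eq[symmetric] by (simp only: distrib_left)
  then have "?k \<le> (1 - ?k) * c - \<mu>" by (simp add: algebra_simps)
  from mult_right_mono[OF this, of ?N] vertices.form_nonneg[OF form_domain_l2[OF u]]
  have "?k * ?N \<le> (1 - ?k) * (c * ?N) - \<mu> * ?N" by (simp add: algebra_simps)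
  also have "(1 - ?k) * (c * ?N) \<le> (1 - ?k) * (?Q + ?P)"
    using bounded_below[OF u] \<open>?k \<le> 1\<close> by (intro mult_left_mono) auto
  also have "\<dots> \<le> (1 - ?k) * ?Q + ?P"
  proof -
    have "0 \<le> ?k * ?P"
      using coercivity_pos[OF assms(1)] p_nonneg by (intro mult_nonneg_nonneg sum_nonneg) auto
    then show ?thesis by (simp add: algebra_simps)
  qed
  finally show ?thesis
    by (simp add: form_inner_def perturbed_def power2_eq_square algebra_simps)
qed

lemma function_inner_space_perturbed:
  assumes "\<mu> < c"
  shows "function_inner_space (form_domain b m) (perturbed \<mu>)"
proof (unfold_locales, goal_cases)
  case 1
  show ?case by (rule form.zero_mem)
next
  case (2 u v s t)
  then show ?case by (rule form.lincomb_mem)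
next
  case (3 u v)
  then show ?case
    using energy.form_commute vertices.form_commute form_domain_l2
    by (simp add: perturbed_def mult_ac)
next
  case (4 u v z s t)
  then show ?case
    by (simp add: perturbed_def energy.form_lincomb vertices.form_lincomb form_domain_l2
        algebra_simps sum.distrib sum_distrib_left)
next
  case (5 u)
  have "0 \<le> coercivity \<mu> * form_inner u u"
    using coercivity_pos[OF assms] form.form_nonneg[OF 5] by simp
  with perturbed_coercive[OF assms 5] show ?case by simp
qed

text \<open>By coercivity and completeness of the form domain, the perturbed form is the inner product
  of a Hilbert space, on which \<open>v \<mapsto> \<langle>f, v\<rangle>\<close> is a bounded functional.\<close>

lemma perturbed_problem_solvable:
  assumes "\<mu> < c" and f: "f \<in> l2 m"
  shows "\<exists>u\<in>form_domain b m. \<forall>v\<in>form_domain b m. perturbed \<mu> u v = l2_inner m f v"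
proof -
  interpret H: function_inner_space "form_domain b m" "perturbed \<mu>"
    by (rule function_inner_space_perturbed) fact
  let ?k = "coercivity \<mu>"
  have k: "?k > 0" by (rule coercivity_pos) fact
  show ?thesis
  proof (rule H.riesz_representation)
    fix s assume s: "\<And>n. s n \<in> form_domain b m" and "H.form_Cauchy s"
    have d: "(\<lambda>x. s n x - s k x) \<in> form_domain b m" for n k by (intro form.diff_mem s)
    have "form.form_Cauchy s"
      unfolding form.form_Cauchy_def
    proof (intro allI impI)
      fix e :: real assume "e > 0"
      then have "?k * e > 0" using k by simp
      with \<open>H.form_Cauchy s\<close> obtain N where N: "\<forall>n\<ge>N. \<forall>k\<ge>N.
          perturbed \<mu> (\<lambda>i. s n i - s k i) (\<lambda>i. s n i - s k i) < ?k * e"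
        unfolding H.form_Cauchy_def by blast
      have "form_inner (\<lambda>i. s n i - s k i) (\<lambda>i. s n i - s k i) < e" if "n \<ge> N" "k \<ge> N" for n k
      proof -
        have "?k * form_inner (\<lambda>i. s n i - s k i) (\<lambda>i. s n i - s k i) < ?k * e"
          using perturbed_coercive[OF \<open>\<mu> < c\<close> d[of n k]] N that by fastforce
        then show ?thesis using k by simp
      qed
      then show "\<exists>N. \<forall>n\<ge>N. \<forall>k\<ge>N. form_inner (\<lambda>i. s n i - s k i) (\<lambda>i. s n i - s k i) < e"
        by blast
    qed
    then obtain u where u: "u \<in> form_domain b m"
      and lim: "(\<lambda>n. form_inner (\<lambda>x. s n x - u x) (\<lambda>x. s n x - u x)) \<longlonglongrightarrow> 0"
      using form_domain_complete[of s, OF s] by blast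
    note parts = form_convergence_parts[OF s u lim]
    have "(\<lambda>n. perturbed \<mu> (\<lambda>x. s n x - u x) (\<lambda>x. s n x - u x))
        \<longlonglongrightarrow> 0 - \<mu> * 0 + (\<Sum>x\<in>K. p x * (u x - u x) * (u x - u x))"
      unfolding perturbed_def by (intro tendsto_intros parts)
    then show "\<exists>u\<in>form_domain b m. (\<lambda>n. perturbed \<mu> (\<lambda>i. s n i - u i) (\<lambda>i. s n i - u i)) \<longlonglongrightarrow> 0"
      using u by auto
  next
    fix u v :: "'a \<Rightarrow> real" and s t :: real
    assume "u \<in> form_domain b m" "v \<in> form_domain b m"
    then show "l2_inner m f (\<lambda>i. s * u i + t * v i) = s * l2_inner m f u + t * l2_inner m f v"
      using vertices.form_lincomb[of u v f] vertices.form_commute[of f] vertices.lincomb_mem[of u v]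
        form_domain_l2 f by simp
  next
    fix v assume v: "v \<in> form_domain b m"
    have "?k * l2_inner m v v \<le> ?k * form_inner v v"
      using k energy.form_nonneg[OF v] by (simp add: form_inner_def)
    also have "\<dots> \<le> perturbed \<mu> v v" by (rule perturbed_coercive) fact+
    finally have "l2_inner m v v \<le> perturbed \<mu> v v / ?k" using k by (simp add: field_simps)
    from mult_left_mono[OF this vertices.form_nonneg[OF f]]
    show "(l2_inner m f v)\<^sup>2 \<le> l2_inner m f f / ?k * perturbed \<mu> v v"
      using vertices.cauchy_schwarz[OF f form_domain_l2[OF v]] by simp
  qed
qed

definition solution :: "real \<Rightarrow> ('a \<Rightarrow> real) \<Rightarrow> 'a \<Rightarrow> real" where
  "solution \<mu> f = (SOME u. u \<in> form_domain b m \<and>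
     (\<forall>v\<in>form_domain b m. perturbed \<mu> u v = l2_inner m f v))"

lemma
  assumes "\<mu> < c" "f \<in> l2 m"
  shows solution_mem: "solution \<mu> f \<in> form_domain b m"
    and solution_eq: "v \<in> form_domain b m \<Longrightarrow> perturbed \<mu> (solution \<mu> f) v = l2_inner m f v"
proof -
  have "solution \<mu> f \<in> form_domain b m \<and>
     (\<forall>v\<in>form_domain b m. perturbed \<mu> (solution \<mu> f) v = l2_inner m f v)"
    using someI_ex[OF perturbed_problem_solvable[OF assms, unfolded Bex_def]] by (simp add: solution_def)
  then show "solution \<mu> f \<in> form_domain b m"
    "v \<in> form_domain b m \<Longrightarrow> perturbed \<mu> (solution \<mu> f) v = l2_inner m f v" by blast+
qed


text \<open>The Fredholm alternative. The equation is solved for the perturbed form with the right-hand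
  sides \<open>f\<close> (index \<open>None\<close>) and all point masses on \<open>K\<close>. A combination of these \<open>card K + 1\<close> solutions
  satisfies the unperturbed equation, with a multiple of \<open>f\<close> on the right, once the contributions of the
  point masses cancel the potential. These are \<open>card K\<close> linear conditions, so there is a nontrivial
  combination; if the multiple of \<open>f\<close> were zero, it would be an eigenfunction.\<close>

lemma shifted_surjective:
  assumes \<mu>: "\<mu> < c" and trivial: "\<And>u. u \<in> eigen \<mu> \<Longrightarrow> u = (\<lambda>x. 0)" and f: "f \<in> l2 m"
  shows "\<exists>u\<in>form_domain b m. \<forall>v\<in>form_domain b m.
    energy_bilinear b u v - \<mu> * l2_inner m u v = l2_inner m f v"
proof -
  interpret H: function_inner_space "form_domain b m" "perturbed \<mu>"
    by (rule function_inner_space_perturbed) fact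
  define rhs where "rhs = case_option f point_mass"
  define g where "g k = solution \<mu> (rhs k)" for k
  have rhs_l2: "rhs k \<in> l2 m" for k
    by (cases k) (simp_all add: rhs_def f point_mass_l2)
  note g_mem = solution_mem[OF \<mu> rhs_l2, folded g_def] and g_eq = solution_eq[OF \<mu> rhs_l2, folded g_def]
  define I where "I = insert None (Some ` K)"
  have I: "finite I" "card K < card I"
    using finite_K by (simp_all add: I_def card_insert_if card_image image_iff)
  have sum_I: "(\<Sum>k\<in>I. F k) = F None + (\<Sum>x\<in>K. F (Some x))" for F :: "'a option \<Rightarrow> real"
    using finite_K by (simp add: I_def sum.reindex image_iff)
  obtain w where w: "\<exists>k\<in>I. w k \<noteq> 0"
    "\<And>x. x \<in> K \<Longrightarrow> (\<Sum>k\<in>I. ((if k = Some x then m x else 0) - p x * g k x) * w k) = 0"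
    using underdetermined_system[OF finite_K I,
        of "\<lambda>x k. (if k = Some x then m x else 0) - p x * g k x"] by blast
  define u where "u = (\<lambda>x. \<Sum>k\<in>I. w k * g k x)"
  have u: "u \<in> form_domain b m" unfolding u_def by (intro form.sum_mem g_mem)
  have balance: "w (Some x) * m x = p x * u x" if "x \<in> K" for x
  proof -
    have "(\<Sum>k\<in>I. (if k = Some x then m x else 0) * w k) = w (Some x) * m x"
      using that I(1) by (simp add: I_def if_distrib[of "\<lambda>r. r * _"] cong: if_cong)
    moreover have "(\<Sum>k\<in>I. ((if k = Some x then m x else 0) - p x * g k x) * w k)
        = (\<Sum>k\<in>I. (if k = Some x then m x else 0) * w k) - p x * u x"
      unfolding u_def sum_distrib_left sum_subtractf[symmetric]
      by (rule sum.cong) (auto simp: algebra_simps)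
    ultimately show ?thesis using w(2)[OF that] by simp
  qed
  have pert_u: "perturbed \<mu> u v = w None * l2_inner m f v + (\<Sum>x\<in>K. w (Some x) * m x * v x)"
    if v: "v \<in> form_domain b m" for v
  proof -
    have "perturbed \<mu> u v = (\<Sum>k\<in>I. w k * l2_inner m (rhs k) v)"
      unfolding u_def using H.form_sum[of I g v w] g_mem g_eq v by simp
    then show ?thesis
      using form_domain_l2[OF v] by (simp add: sum_I rhs_def l2_inner_point_mass_left mult_ac)
  qed
  have eq: "energy_bilinear b u v - \<mu> * l2_inner m u v = w None * l2_inner m f v"
    if v: "v \<in> form_domain b m" for v
  proof -
    have "(\<Sum>x\<in>K. w (Some x) * m x * v x) = (\<Sum>x\<in>K. p x * u x * v x)"
      using balance by (intro sum.cong) auto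
    then show ?thesis using pert_u[OF v] by (simp add: perturbed_def)
  qed
  have "w None \<noteq> 0"
  proof
    assume None: "w None = 0"
    then have "u \<in> eigen \<mu>" using eq u by (simp add: eigenspace_laplacian_iff)
    then have "u = (\<lambda>x. 0)" by (rule trivial)
    then have "w (Some x) = 0" if "x \<in> K" for x
      using balance[OF that] m_pos[of x] by simp
    with None w(1) show False by (auto simp: I_def)
  qed
  show ?thesis
  proof (intro bexI ballI)
    show "(\<lambda>x. (1 / w None) * u x) \<in> form_domain b m" by (rule form.scale_mem[OF u])
    fix v assume v: "v \<in> form_domain b m"
    have "energy_bilinear b (\<lambda>x. (1 / w None) * u x) v - \<mu> * l2_inner m (\<lambda>x. (1 / w None) * u x) v
        = (1 / w None) * (energy_bilinear b u v - \<mu> * l2_inner m u v)"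
      unfolding energy.form_scale[OF u v] vertices.form_scale[OF form_domain_l2[OF u] form_domain_l2[OF v]]
      by (simp add: right_diff_distrib)
    also have "\<dots> = l2_inner m f v" unfolding eq[OF v] using \<open>w None \<noteq> 0\<close> by simp
    finally show "energy_bilinear b (\<lambda>x. (1 / w None) * u x) v - \<mu> * l2_inner m (\<lambda>x. (1 / w None) * u x) v
        = l2_inner m f v" .
  qed
qed

text \<open>The bound for the inverse: testing the equation with the solution \<open>z x\<close> for a point mass at
  \<open>x\<close> and using the symmetry of the form bounds \<open>u x\<close> by \<open>f\<close>. This controls the potential on \<open>K\<close>, and
  coercivity controls \<open>u\<close> by \<open>f\<close> and the potential.\<close>

lemma mem_resolvent_set_if_no_eigenfunction:
  assumes \<mu>: "\<mu> < c" and trivial: "\<And>u. u \<in> eigen \<mu> \<Longrightarrow> u = (\<lambda>x. 0)"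
  shows "\<mu> \<in> resolvent_set m (laplacian_domain b m) (laplacian b m)"
proof -
  let ?D = "form_domain b m" and ?A = "laplacian_domain b m"
  let ?T = "\<lambda>u x. laplacian b m u x - \<mu> * u x"
  have T: "u \<in> ?D" "?T u \<in> l2 m"
    "\<And>v. v \<in> ?D \<Longrightarrow> energy_bilinear b u v - \<mu> * l2_inner m u v = l2_inner m (?T u) v"
    if "u \<in> ?A" for u
    using laplacian_shift_eq_iff[of u \<mu> "?T u"] that by blast+
  have inj: "inj_on ?T ?A"
  proof (rule inj_onI)
    fix u v assume uv: "u \<in> ?A" "v \<in> ?A" "?T u = ?T v"
    have "(\<lambda>x. u x - v x) \<in> eigen \<mu>"
      unfolding eigenspace_laplacian_iff
    proof (intro conjI ballI)
      show "(\<lambda>x. u x - v x) \<in> ?D" by (intro form.diff_mem T uv)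
      fix z assume z: "z \<in> ?D"
      show "energy_bilinear b (\<lambda>x. u x - v x) z = \<mu> * l2_inner m (\<lambda>x. u x - v x) z"
        using T(3)[OF uv(1) z] T(3)[OF uv(2) z] T(1) uv form_domain_l2 z
        by (simp add: energy.form_diff vertices.form_diff right_diff_distrib)
    qed
    from trivial[OF this] show "u = v" by (simp add: fun_eq_iff)
  qed
  have surj: "\<exists>u\<in>?A. ?T u = f" if f: "f \<in> l2 m" for f
    using shifted_surjective[OF \<mu> trivial f] laplacian_shift_eq_iff[of _ \<mu> f] f by blast
  have bij: "bij_betw ?T ?A (l2 m)"
    unfolding bij_betw_def using inj T(2) surj by blast
  have "\<exists>z\<in>?A. ?T z = point_mass x" for x by (rule surj[OF point_mass_l2])
  then obtain z where z: "\<And>x. z x \<in> ?A" "\<And>x. ?T (z x) = point_mass x" by metis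
  define k where "k = coercivity \<mu>"
  have k: "k > 0" unfolding k_def by (rule coercivity_pos) fact
  define C where "C = (\<Sum>x\<in>K. p x * (l2_inner m (z x) (z x) / (m x)\<^sup>2))"
  have z_D: "z x \<in> ?D" for x by (rule T(1)[OF z(1)])
  have "C \<ge> 0"
    unfolding C_def using p_nonneg vertices.form_nonneg[OF form_domain_l2[OF z_D]]
    by (intro sum_nonneg mult_nonneg_nonneg divide_nonneg_nonneg) auto
  have est: "l2_norm m u \<le> sqrt (2 / k * (1 / (2 * k) + C)) * l2_norm m (?T u)" if u: "u \<in> ?A" for u
  proof -
    note uT = T[OF u]
    let ?N = "l2_inner m u u" and ?F = "l2_inner m (?T u) (?T u)"
    have N: "?N \<ge> 0" by (intro vertices.form_nonneg form_domain_l2 uT)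
    have F: "?F \<ge> 0" by (intro vertices.form_nonneg uT)
    have pt: "(u x)\<^sup>2 \<le> ?F * (l2_inner m (z x) (z x) / (m x)\<^sup>2)" for x
    proof -
      have "u x * m x = l2_inner m (point_mass x) u"
        by (simp add: l2_inner_point_mass_left form_domain_l2 uT)
      also have "\<dots> = energy_bilinear b (z x) u - \<mu> * l2_inner m (z x) u"
        using T(3)[OF z(1) uT(1), of x] z(2)[of x] by simp
      also have "\<dots> = l2_inner m (?T u) (z x)"
        using uT(3)[OF z_D[of x]] energy.form_commute[OF uT(1) z_D[of x]]
          vertices.form_commute[OF form_domain_l2[OF uT(1)] form_domain_l2[OF z_D[of x]]] by simp
      finally have "(u x * m x)\<^sup>2 \<le> ?F * l2_inner m (z x) (z x)"
        using vertices.cauchy_schwarz[OF uT(2) form_domain_l2[OF z_D[of x]]] by simp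
      then show ?thesis using m_pos[of x] by (simp add: power_mult_distrib pos_le_divide_eq)
    qed
    have "k * ?N \<le> k * form_inner u u"
      using k energy.form_nonneg[OF uT(1)] by (simp add: form_inner_def)
    also have "\<dots> \<le> perturbed \<mu> u u" unfolding k_def by (rule perturbed_coercive[OF \<mu> uT(1)])
    also have "\<dots> = l2_inner m (?T u) u + (\<Sum>x\<in>K. p x * (u x)\<^sup>2)"
      using uT(3)[OF uT(1)] by (simp add: perturbed_def power2_eq_square mult.assoc)
    also have "(\<Sum>x\<in>K. p x * (u x)\<^sup>2) \<le> (\<Sum>x\<in>K. p x * (?F * (l2_inner m (z x) (z x) / (m x)\<^sup>2)))"
      by (intro sum_mono mult_left_mono pt p_nonneg)
    also have "\<dots> = ?F * C" unfolding C_def sum_distrib_left by (simp only: mult_ac)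
    \<comment> \<open>Young's inequality, so that half of \<open>k * \<parallel>u\<parallel>\<^sup>2\<close> can be absorbed on the left.\<close>
    also have "l2_inner m (?T u) u \<le> k / 2 * ?N + ?F / (2 * k)"
    proof -
      have "2 * \<bar>l2_inner m (\<lambda>x. (1 / k) * ?T u x) u\<bar>
          \<le> l2_inner m (\<lambda>x. (1 / k) * ?T u x) (\<lambda>x. (1 / k) * ?T u x) + ?N"
        by (intro vertices.abs_form_le_mean vertices.scale_mem uT form_domain_l2)
      moreover have "l2_inner m (\<lambda>x. (1 / k) * ?T u x) u = 1 / k * l2_inner m (?T u) u"
        by (intro vertices.form_scale uT form_domain_l2)
      moreover have "l2_inner m (\<lambda>x. (1 / k) * ?T u x) (\<lambda>x. (1 / k) * ?T u x) = (1 / k)\<^sup>2 * ?F"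
        using vertices.form_square_lincomb[OF uT(2) uT(2), of "1 / k" 0] by simp
      ultimately have "2 * (1 / k * l2_inner m (?T u) u) \<le> (1 / k)\<^sup>2 * ?F + ?N"
        using abs_ge_self[of "1 / k * l2_inner m (?T u) u"] by linarith
      from mult_left_mono[OF this, of "k / 2"] k show ?thesis
        by (simp add: distrib_left power2_eq_square)
    qed
    finally have "?N * k \<le> (2 * (1 / (2 * k) + C)) * ?F" by (simp add: algebra_simps)
    then have "?N \<le> (2 / k * (1 / (2 * k) + C)) * ?F"
      using k pos_le_divide_eq[of k ?N] by simp
    from real_sqrt_le_mono[OF this] show ?thesis
      unfolding l2_norm_def real_sqrt_mult .
  qed
  show ?thesis
    unfolding resolvent_set_def mem_Collect_eq using bij est by blast
qed

text \<open>An eigenfunction \<open>u\<close> solves the perturbed equation with right-hand side \<open>p * u / m\<close>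
  supported on \<open>K\<close>. So \<open>u\<close> is the combination of the solutions \<open>g x\<close> for the point masses with
  coefficients \<open>p x * u x / m x\<close>.\<close>

lemma eigenspace_finite_dimensional:
  assumes \<mu>: "\<mu> < c"
  shows "finite_dimensional (eigen \<mu>)"
proof -
  interpret H: function_inner_space "form_domain b m" "perturbed \<mu>"
    by (rule function_inner_space_perturbed) fact
  define g where "g x = solution \<mu> (point_mass x)" for x
  note g_mem = solution_mem[OF \<mu> point_mass_l2, folded g_def]
    and g_eq = solution_eq[OF \<mu> point_mass_l2, folded g_def]
  have inj: "inj_on g K"
  proof (rule inj_onI)
    fix x y assume "g x = g y"
    then have "l2_inner m (point_mass x) (point_mass x) = l2_inner m (point_mass y) (point_mass x)"
      using g_eq point_mass_form_domain by metis
    then show "x = y"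
      using m_pos[of x] unfolding l2_inner_point_mass by (simp add: point_mass_def split: if_splits)
  qed
  have "\<exists>\<gamma>. \<forall>x. u x = (\<Sum>f\<in>g ` K. \<gamma> f * f x)" if "u \<in> eigen \<mu>" for u
  proof -
    have u: "u \<in> form_domain b m"
      "\<And>v. v \<in> form_domain b m \<Longrightarrow> energy_bilinear b u v = \<mu> * l2_inner m u v"
      using that by (auto simp: eigenspace_laplacian_iff)
    define w where "w x = p x * u x / m x" for x
    define r where "r = (\<lambda>y. u y - (\<Sum>x\<in>K. w x * g x y))"
    have s_mem: "(\<lambda>y. \<Sum>x\<in>K. w x * g x y) \<in> form_domain b m"
      by (intro form.sum_mem g_mem)
    have r: "r \<in> form_domain b m" unfolding r_def by (intro form.diff_mem u s_mem)
    have "perturbed \<mu> (\<lambda>y. \<Sum>x\<in>K. w x * g x y) r = (\<Sum>x\<in>K. w x * (r x * m x))"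
      using H.form_sum[of K g r w] g_mem g_eq r form_domain_l2[OF r]
      by (simp add: l2_inner_point_mass_left)
    also have "\<dots> = (\<Sum>x\<in>K. p x * u x * r x)"
      using m_pos by (intro sum.cong) (auto simp: w_def less_imp_neq[symmetric])
    also have "\<dots> = perturbed \<mu> u r" using u(2)[OF r] by (simp add: perturbed_def)
    finally have "perturbed \<mu> r r = 0"
      using H.form_diff[OF u(1) s_mem r] unfolding r_def[symmetric] by simp
    then have "coercivity \<mu> * form_inner r r \<le> 0"
      using perturbed_coercive[OF \<mu> r] by simp
    then have "form_inner r r \<le> 0" using coercivity_pos[OF \<mu>] by (simp add: mult_le_0_iff)
    then have "l2_inner m r r \<le> 0" using energy.form_nonneg[OF r] by (simp add: form_inner_def)
    have "r y = 0" for y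
    proof -
      have "(r y)\<^sup>2 * m y \<le> 0"
        using vertices.pointwise_le_l2_inner[OF form_domain_l2[OF r], of y] \<open>l2_inner m r r \<le> 0\<close> by simp
      then show ?thesis using m_pos[of y] by (simp add: mult_le_0_iff)
    qed
    then have "u y = (\<Sum>x\<in>K. w x * g x y)" for y by (simp add: r_def)
    moreover have "(\<Sum>x\<in>K. w x * g x y) = (\<Sum>f\<in>g ` K. w (the_inv_into K g f) * f y)" for y
      using inj by (simp add: sum.reindex the_inv_into_f_f)
    ultimately show ?thesis
      by (intro exI[of _ "\<lambda>f. w (the_inv_into K g f)"] allI) simp
  qed
  then show ?thesis
    unfolding finite_dimensional_def using finite_K by blast
qed

text \<open>The easy half of the min-max principle. On the span of mutually orthogonal eigenfunctions
  the form \<open>Q - c\<close> is negative definite, whereas it is nonnegative on functions that vanish on \<open>K\<close>.\<close>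

lemma card_eigenvalues_below_le:
  assumes "finite F" and F: "\<And>\<mu>. \<mu> \<in> F \<Longrightarrow> \<mu> < c \<and> (\<exists>u\<in>eigen \<mu>. u \<noteq> (\<lambda>x. 0))"
  shows "card F \<le> card K"
proof (rule ccontr)
  assume "\<not> card F \<le> card K"
  then have "card K < card F" by simp
  obtain e where e: "\<And>\<mu>. \<mu> \<in> F \<Longrightarrow> e \<mu> \<in> eigen \<mu>" "\<And>\<mu>. \<mu> \<in> F \<Longrightarrow> e \<mu> \<noteq> (\<lambda>x. 0)"
    using F by metis
  have e_mem: "e \<mu> \<in> form_domain b m" if "\<mu> \<in> F" for \<mu>
    using e(1)[OF that] by (simp add: eigenspace_laplacian_iff)
  have e_eq: "energy_bilinear b (e \<mu>) v = \<mu> * l2_inner m (e \<mu>) v"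
    if "\<mu> \<in> F" "v \<in> form_domain b m" for \<mu> v
    using e(1)[OF that(1)] that(2) by (simp add: eigenspace_laplacian_iff)
  have orth: "l2_inner m (e \<mu>) (e \<nu>) = 0" if "\<mu> \<in> F" "\<nu> \<in> F" "\<mu> \<noteq> \<nu>" for \<mu> \<nu>
  proof -
    have "\<mu> * l2_inner m (e \<mu>) (e \<nu>) = \<nu> * l2_inner m (e \<mu>) (e \<nu>)"
      using e_eq e_mem that energy.form_commute vertices.form_commute form_domain_l2 by metis
    then show ?thesis using that(3) by simp
  qed
  have e_pos: "l2_inner m (e \<mu>) (e \<mu>) > 0" if \<mu>: "\<mu> \<in> F" for \<mu>
  proof -
    obtain x where "e \<mu> x \<noteq> 0" using e(2)[OF \<mu>] by auto
    then have "0 < (e \<mu> x)\<^sup>2 * m x" using m_pos[of x] by simp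
    with vertices.pointwise_le_l2_inner[OF form_domain_l2[OF e_mem[OF \<mu>]], of x] show ?thesis by simp
  qed
  obtain w where w: "\<exists>\<mu>\<in>F. w \<mu> \<noteq> 0" "\<And>x. x \<in> K \<Longrightarrow> (\<Sum>\<mu>\<in>F. e \<mu> x * w \<mu>) = 0"
    using underdetermined_system[OF finite_K \<open>finite F\<close> \<open>card K < card F\<close>, of "\<lambda>x \<mu>. e \<mu> x"] by blast
  define u where "u = (\<lambda>x. \<Sum>\<mu>\<in>F. w \<mu> * e \<mu> x)"
  have u: "u \<in> form_domain b m" unfolding u_def by (intro form.sum_mem e_mem)
  have inner_u: "l2_inner m (e \<mu>) u = w \<mu> * l2_inner m (e \<mu>) (e \<mu>)" if "\<mu> \<in> F" for \<mu>
  proof -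
    have "l2_inner m (e \<mu>) u = (\<Sum>\<nu>\<in>F. w \<nu> * l2_inner m (e \<nu>) (e \<mu>))"
      unfolding vertices.form_commute[OF form_domain_l2[OF e_mem[OF that]] form_domain_l2[OF u]]
      unfolding u_def by (intro vertices.form_sum form_domain_l2 e_mem that)
    also have "\<dots> = (\<Sum>\<nu>\<in>F. if \<nu> = \<mu> then w \<mu> * l2_inner m (e \<mu>) (e \<mu>) else 0)"
      using orth that by (intro sum.cong) auto
    finally show ?thesis using that \<open>finite F\<close> by simp
  qed
  have "energy_bilinear b u u = (\<Sum>\<mu>\<in>F. w \<mu> * energy_bilinear b (e \<mu>) u)"
    using energy.form_sum[of F e u w] e_mem u unfolding u_def[symmetric] by simp
  also have "\<dots> = (\<Sum>\<mu>\<in>F. \<mu> * ((w \<mu>)\<^sup>2 * l2_inner m (e \<mu>) (e \<mu>)))"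
    using e_eq u inner_u by (intro sum.cong) (auto simp: power2_eq_square)
  finally have Q: "energy_bilinear b u u = (\<Sum>\<mu>\<in>F. \<mu> * ((w \<mu>)\<^sup>2 * l2_inner m (e \<mu>) (e \<mu>)))" .
  have "l2_inner m u u = (\<Sum>\<mu>\<in>F. w \<mu> * l2_inner m (e \<mu>) u)"
    using vertices.form_sum[of F e u w] e_mem u form_domain_l2 unfolding u_def[symmetric] by simp
  also have "\<dots> = (\<Sum>\<mu>\<in>F. (w \<mu>)\<^sup>2 * l2_inner m (e \<mu>) (e \<mu>))"
    using inner_u by (intro sum.cong) (auto simp: power2_eq_square)
  finally have N: "l2_inner m u u = (\<Sum>\<mu>\<in>F. (w \<mu>)\<^sup>2 * l2_inner m (e \<mu>) (e \<mu>))" .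
  have "u x = 0" if "x \<in> K" for x
    using w(2)[OF that] by (simp add: u_def mult.commute)
  then have "c * l2_inner m u u \<le> energy_bilinear b u u"
    using bounded_below[OF u] by simp
  then have "0 \<le> (\<Sum>\<mu>\<in>F. (\<mu> - c) * ((w \<mu>)\<^sup>2 * l2_inner m (e \<mu>) (e \<mu>)))"
    unfolding Q N by (simp add: left_diff_distrib sum_subtractf sum_distrib_left)
  moreover have "(\<Sum>\<mu>\<in>F. (\<mu> - c) * ((w \<mu>)\<^sup>2 * l2_inner m (e \<mu>) (e \<mu>))) < 0"
  proof -
    obtain \<nu> where \<nu>: "\<nu> \<in> F" "w \<nu> \<noteq> 0" using w(1) by blast
    have "(\<mu> - c) * ((w \<mu>)\<^sup>2 * l2_inner m (e \<mu>) (e \<mu>)) \<le> 0" if "\<mu> \<in> F" for \<mu>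
      using F[OF that] e_pos[OF that] by (intro mult_nonpos_nonneg) auto
    moreover have "(\<nu> - c) * ((w \<nu>)\<^sup>2 * l2_inner m (e \<nu>) (e \<nu>)) < 0"
      using F[OF \<nu>(1)] e_pos[OF \<nu>(1)] \<nu>(2) by (intro mult_neg_pos) auto
    ultimately have "(\<Sum>\<mu>\<in>F. (\<mu> - c) * ((w \<mu>)\<^sup>2 * l2_inner m (e \<mu>) (e \<mu>))) < (\<Sum>\<mu>\<in>F. 0)"
      using \<nu>(1) \<open>finite F\<close> by (intro sum_strict_mono_ex1) auto
    then show ?thesis by simp
  qed
  ultimately show False by simp
qed

theorem spectrum_below_discrete:
  assumes \<mu>: "\<mu> < c"
  shows "\<mu> \<notin> essential_spectrum m (laplacian_domain b m) (laplacian b m)"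
proof
  let ?\<sigma> = "spectrum_of m (laplacian_domain b m) (laplacian b m)"
  assume ess: "\<mu> \<in> essential_spectrum m (laplacian_domain b m) (laplacian b m)"
  then have "\<mu> \<in> ?\<sigma>" by (simp add: essential_spectrum_def)
  define E where "E = {\<nu>. \<nu> < c \<and> (\<exists>u\<in>eigen \<nu>. u \<noteq> (\<lambda>x. 0))}"
  have spectrum_E: "\<nu> \<in> E" if "\<nu> \<in> ?\<sigma>" "\<nu> < c" for \<nu>
    using mem_resolvent_set_if_no_eigenfunction[of \<nu>] that by (auto simp: E_def spectrum_of_def)
  have "finite E"
    using card_eigenvalues_below_le
    by (intro finite_if_finite_subsets_card_bdd[of E "card K", THEN conjunct1]) (auto simp: E_def subset_iff)
  then have "open ({..<c} - (E - {\<mu>}))"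
    by (intro open_Diff finite_imp_closed) auto
  moreover have "({..<c} - (E - {\<mu>})) \<inter> ?\<sigma> = {\<mu>}"
    using spectrum_E \<mu> \<open>\<mu> \<in> ?\<sigma>\<close> by auto
  ultimately have "\<mu> isolated_in ?\<sigma>"
    using \<open>\<mu> \<in> ?\<sigma>\<close> unfolding isolated_in_def by blast
  moreover have "\<exists>u\<in>eigen \<mu>. u \<noteq> (\<lambda>x. 0)"
    using spectrum_E[OF \<open>\<mu> \<in> ?\<sigma>\<close> \<mu>] by (simp add: E_def)
  ultimately show False
    using ess eigenspace_finite_dimensional[OF \<mu>]
    by (simp add: essential_spectrum_def discrete_spectrum_def)
qed

end

section \<open>The bottom of the essential spectrum\<close>

text \<open>Since \<open>\<alpha>\<close> may be infinite, the half square cannot be approximated by continuity in the reals;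
  a real number strictly between \<open>sqrt (2 * \<mu>)\<close> and \<open>\<alpha>\<close> does the job.\<close>

lemma real_below_half_square:
  assumes "0 \<le> \<mu>" "ereal \<mu> < enn2ereal (\<alpha>\<^sup>2 / 2)"
  obtains a where "0 \<le> a" "\<mu> < a\<^sup>2 / 2" "ennreal a < \<alpha>"
proof -
  have "ennreal (sqrt (2 * \<mu>)) < \<alpha>"
  proof (rule ccontr)
    assume "\<not> ?thesis"
    then have "\<alpha>\<^sup>2 \<le> (ennreal (sqrt (2 * \<mu>)))\<^sup>2" by (intro power_mono) auto
    also have "\<dots> = ennreal (2 * \<mu>)" using assms(1) by (simp add: ennreal_power)
    finally have "\<alpha>\<^sup>2 / 2 \<le> ennreal (2 * \<mu>) / 2" by (rule divide_right_mono_ennreal)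
    also have "\<dots> = ennreal \<mu>" using assms(1) divide_ennreal[of "2 * \<mu>" 2] by simp
    finally have "enn2ereal (\<alpha>\<^sup>2 / 2) \<le> enn2ereal (ennreal \<mu>)" by (simp add: less_eq_ennreal.rep_eq)
    then show False using assms by (simp add: enn2ereal_ennreal)
  qed
  then obtain y where y: "ennreal (sqrt (2 * \<mu>)) < y" "y < \<alpha>" using dense by blast
  then obtain a where a: "y = ennreal a" "a \<ge> 0" by (cases y) auto
  have "sqrt (2 * \<mu>) < a" using y(1) a assms(1) by (simp add: ennreal_less_iff)
  then have "(sqrt (2 * \<mu>))\<^sup>2 < a\<^sup>2" using assms(1) by (intro power_strict_mono) auto
  then show ?thesis using that[of a] a y(2) assms(1) by simp
qed

theorem theorem3p3:
  fixes m :: "'a \<Rightarrow> real" and b d :: "'a \<Rightarrow> 'a \<Rightarrow> real"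
  assumes "countable (UNIV :: 'a set)" and "infinite (UNIV :: 'a set)"
    and "\<And>x. 0 < m x"
    and "graph_over b"
    and "intrinsic_metric b m d"
    and "finitely_supported \<subseteq> laplacian_domain b m"
  shows "ess_spectrum_bottom m (laplacian_domain b m) (laplacian b m)
           \<ge> enn2ereal ((isoperimetric_const_infinity b m d)\<^sup>2 / 2)"
proof -
  let ?\<alpha> = "isoperimetric_const_infinity b m d"
  let ?\<sigma> = "essential_spectrum m (laplacian_domain b m) (laplacian b m)"
  interpret intrinsic_graph m b d
    by unfold_locales (use assms in \<open>auto simp: laplacian_domain_def\<close>)
  have "enn2ereal (?\<alpha>\<^sup>2 / 2) \<le> ereal \<mu>" if "\<mu> \<in> ?\<sigma>" for \<mu>
  proof (rule ccontr)
    assume "\<not> ?thesis"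
    then have "ereal \<mu> < enn2ereal (?\<alpha>\<^sup>2 / 2)" by simp
    show False
    proof (cases "\<mu> < 0")
      case True
      \<comment> \<open>For negative \<open>\<mu>\<close> the energy itself is bounded below by \<open>0\<close>, with no potential.\<close>
      interpret bounded_below_with_potential m b "{}" "\<lambda>_. 0" 0
        by unfold_locales (simp_all add: energy.form_nonneg)
      show False using spectrum_below_discrete[OF True] that by blast
    next
      case False
      with \<open>ereal \<mu> < _\<close> obtain a where a: "0 \<le> a" "\<mu> < a\<^sup>2 / 2" "ennreal a < ?\<alpha>"
        using real_below_half_square[of \<mu> ?\<alpha>] by auto
      obtain K where K: "finite K" "ennreal a \<le> isoperimetric_const b m d (- K)"
        using a(3) unfolding isoperimetric_const_infinity_def less_SUP_iff Compl_eq_Diff_UNIV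
        by (auto intro: less_imp_le)
      obtain c where c: "\<mu> < c" "c < a\<^sup>2 / 2" using dense[OF a(2)] by blast
      with False have "0 \<le> c" by simp
      obtain p where p: "\<And>x. 0 \<le> p x" "\<And>u. u \<in> form_domain b m \<Longrightarrow>
          c * l2_inner m u u \<le> energy_bilinear b u u + (\<Sum>x\<in>K. p x * (u x)\<^sup>2)"
        using energy_plus_potential_bound[OF isoperimetric_const_le_perimeter[OF K(2) a(1)] a(1) K(1) \<open>0 \<le> c\<close> c(2)]
        by blast
      interpret bounded_below_with_potential m b K p c
        by unfold_locales (use K \<open>0 \<le> c\<close> p in auto)
      show False using spectrum_below_discrete[OF c(1)] that by blast
    qed
  qed
  then show ?thesis
    unfolding ess_spectrum_bottom_def by (intro INF_greatest)
qed

end
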